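(* Let $G$ be an analytic function on $\mathbb{C}_+$ and suppose that $A:f\mapsto Gf'$ generates an analytic semigroup of composition operators on $H^2(\mathbb{C}_+)$. Write $G=u+iv$ where $u$ and $v$ are real functions, and similarly $z=x+iy$. Then there is an $\alpha$ with $0<\alpha<\pi/2$ such that, for every fixed $y\in\mathbb{R}$, $(u\cos\theta+v\sin\theta)/x$ is a decreasing (i.e. non-increasing) function of $x\in(0,\infty)$ for all $\theta\in[-\alpha,\alpha]$.
   Context: $\mathbb{C}_+=\{z\in\mathbb{C}:\operatorname{Re}z>0\}$ and $H^2(\mathbb{C}_+)$ is the Hardy space of this half-plane (analytic $f$ on $\mathbb{C}_+$ with $\sup_{x>0}\int_{\mathbb{R}}|f(x+iy)|^2\,dy<\infty$). A composition operator is $C_\varphi f=f\circ\varphi$ with $\varphi:\mathbb{C}_+\to\mathbb{C}_+$ analytic. A $C_0$-semigroup $(T(t))_{t\ge0}$ on a Banach space $X$ is a family of bounded operators with $T(0)=I$, $T(t+s)=T(t)T(s)$ and $\lim_{t\to0}T(t)x=x$ for all $x\in X$; its generator is $Ax=\lim_{t\to0^+}(T(t)x-x)/t$, on the domain where the limit exists. For $\theta\in(0,\pi/2]$ put $\Sigma_\theta=\{re^{i\alpha}: r\ge 0,\ |\alpha|<\theta\}$. The $C_0$-semigroup $T$ is analytic if for some $\theta\in(0,\pi/2]$ it has an extension $\widetilde T:\Sigma_\theta\to\mathcal{L}(X)$ which is analytic (on $\Sigma_\theta\setminus\{0\}$) and satisfies $\sup\{\|\widetilde T(\xi)\|:\xi\in\Sigma_\theta,\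 |\xi|<1\}<\infty$. A semigroup of composition operators is one all of whose members (on the sector, for an analytic semigroup) are composition operators. *)

theory Defs
  imports "HOL-Complex_Analysis.Complex_Analysis"
begin

definition right_half_plane :: "complex set" where
  "right_half_plane = {z. 0 < Re z}"

definition hardy2_sq :: "(complex \<Rightarrow> complex) \<Rightarrow> ennreal" where
  "hardy2_sq f = (SUP x\<in>{0<..}. \<integral>\<^sup>+y. ennreal ((cmod (f (Complex x y)))\<^sup>2) \<partial>lborel)"

text \<open>Functions on the half-plane are represented by total functions vanishing off it, so that
  equality in \<open>H\<^sup>2\<close> is equality of HOL functions.  The vector space operations are pointwise.\<close>

definition hardy2 :: "(complex \<Rightarrow> complex) set" where
  "hardy2 = {f. f holomorphic_on right_half_plane \<and> hardy2_sq f < \<infinity> \<and>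
                (\<forall>z. z \<notin> right_half_plane \<longrightarrow> f z = 0)}"

definition hardy2_norm :: "(complex \<Rightarrow> complex) \<Rightarrow> real" where
  "hardy2_norm f = sqrt (enn2real (hardy2_sq f))"

text \<open>The Hardy space is a set of functions, not a type, and the scalars are complex, so the
  library's \<open>bounded_linear\<close> and \<open>onorm\<close> do not apply.  Only the values of an operator on
  \<^const>\<open>hardy2\<close> are meaningful.\<close>

type_synonym operator = "(complex \<Rightarrow> complex) \<Rightarrow> (complex \<Rightarrow> complex)"

definition bounded_op :: "operator \<Rightarrow> bool" where
  "bounded_op S \<longleftrightarrow>
     (\<forall>f\<in>hardy2. S f \<in> hardy2) \<and>
     (\<forall>f\<in>hardy2. \<forall>g\<in>hardy2. S (\<lambda>z. f z + g z) = (\<lambda>z. S f z + S g z)) \<and>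
     (\<forall>c. \<forall>f\<in>hardy2. S (\<lambda>z. c * f z) = (\<lambda>z. c * S f z)) \<and>
     (\<exists>K. \<forall>f\<in>hardy2. hardy2_norm (S f) \<le> K * hardy2_norm f)"

definition op_norm :: "operator \<Rightarrow> real" where
  "op_norm S = (SUP f\<in>{f\<in>hardy2. hardy2_norm f \<le> 1}. hardy2_norm (S f))"

definition is_composition_operator :: "operator \<Rightarrow> bool" where
  "is_composition_operator S \<longleftrightarrow>
     (\<exists>\<phi>. \<phi> holomorphic_on right_half_plane \<and> \<phi> ` right_half_plane \<subseteq> right_half_plane \<and>
          (\<forall>f\<in>hardy2. \<forall>z\<in>right_half_plane. S f z = f (\<phi> z)))"

definition C0_semigroup :: "(real \<Rightarrow> operator) \<Rightarrow> bool" where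
  "C0_semigroup T \<longleftrightarrow>
     (\<forall>t\<ge>0. bounded_op (T t)) \<and>
     (\<forall>f\<in>hardy2. T 0 f = f) \<and>
     (\<forall>s\<ge>0. \<forall>t\<ge>0. \<forall>f\<in>hardy2. T (t + s) f = T t (T s f)) \<and>
     (\<forall>f\<in>hardy2. ((\<lambda>t. hardy2_norm (\<lambda>z. T t f z - f z)) \<longlongrightarrow> 0) (at_right 0))"

definition generator_graph ::
    "(real \<Rightarrow> operator) \<Rightarrow> ((complex \<Rightarrow> complex) \<times> (complex \<Rightarrow> complex)) set" where
  "generator_graph T = {(f, g). f \<in> hardy2 \<and> g \<in> hardy2 \<and>
     ((\<lambda>t. hardy2_norm (\<lambda>z. (T t f z - f z) / of_real t - g z)) \<longlongrightarrow> 0) (at_right 0)}"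

text \<open>No domain is prescribed for \<open>f \<mapsto> G f'\<close> beyond that of the generator, i.e. the functions for
  which the defining limit exists.\<close>

definition generated_by :: "(complex \<Rightarrow> complex) \<Rightarrow> (real \<Rightarrow> operator) \<Rightarrow> bool" where
  "generated_by G T \<longleftrightarrow>
     (\<forall>(f, g)\<in>generator_graph T. \<forall>z\<in>right_half_plane. g z = G z * deriv f z)"

definition sector :: "real \<Rightarrow> complex set" where
  "sector \<theta> = {of_real r * cis a |r a. 0 \<le> r \<and> \<bar>a\<bar> < \<theta>}"

text \<open>To be used at interior points of a set on which \<open>S\<close> takes bounded operators as values, so that
  the operator norm is that of a bounded operator for all small \<open>h\<close>.\<close>

definition op_differentiable_at :: "(complex \<Rightarrow> operator) \<Rightarrow> complex \<Rightarrow> bool" where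
  "op_differentiable_at S \<xi> \<longleftrightarrow>
     (\<exists>D. bounded_op D \<and>
        ((\<lambda>h. op_norm (\<lambda>f z. (S (\<xi> + h) f z - S \<xi> f z) / h - D f z)) \<longlongrightarrow> 0) (at 0))"

definition analytic_extension ::
    "real \<Rightarrow> (complex \<Rightarrow> operator) \<Rightarrow> (real \<Rightarrow> operator) \<Rightarrow> bool" where
  "analytic_extension \<theta> S T \<longleftrightarrow>
     (\<forall>\<xi>\<in>sector \<theta>. bounded_op (S \<xi>)) \<and>
     (\<forall>t\<ge>0. \<forall>f\<in>hardy2. S (of_real t) f = T t f) \<and>
     (\<forall>\<xi>\<in>sector \<theta> - {0}. op_differentiable_at S \<xi>) \<and>
     bdd_above ((\<lambda>\<xi>. op_norm (S \<xi>)) ` {\<xi>\<in>sector \<theta>. cmod \<xi> < 1})"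

definition analytic_composition_semigroup :: "(real \<Rightarrow> operator) \<Rightarrow> bool" where
  "analytic_composition_semigroup T \<longleftrightarrow>
     C0_semigroup T \<and>
     (\<exists>\<theta> S. 0 < \<theta> \<and> \<theta> \<le> pi / 2 \<and> analytic_extension \<theta> S T \<and>
            (\<forall>\<xi>\<in>sector \<theta>. is_composition_operator (S \<xi>)))"

end

theory Submission
  imports Defs "HOL-Probability.Sinc_Integral"
begin

text \<open>Every holomorphic self-map \<open>\<phi>\<close> of the right half-plane has the property that
  \<open>Re \<phi>(x + iy) / x\<close> is non-increasing in \<open>x\<close>: by the Schwarz--Pick inequality
  \<open>\<bar>\<phi>'(z)\<bar> Re z \<le> Re \<phi>(z)\<close>, the derivative of this quotient is not positive
  (\<open>Re_over_x_antimono\<close>).  Write \<open>S \<xi> f = f \<circ> \<Phi> \<xi>\<close> for the operators of the semigroup at the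
  times \<open>\<xi>\<close> of the sector.  If for every small angle \<open>\<theta>\<close> the symbols satisfy
  \<open>(\<Phi> (t e\<^sup>-\<^sup>i\<^sup>\<theta>) z - z) / t \<longlongrightarrow> e\<^sup>-\<^sup>i\<^sup>\<theta> G(z)\<close> as \<open>t\<close> tends to \<open>0\<close> along some sequence, then
  \<open>Re (e\<^sup>-\<^sup>i\<^sup>\<theta> G(x + iy)) / x\<close> is a limit of non-increasing functions of \<open>x\<close>, and its numerator
  is \<open>u cos \<theta> + v sin \<theta>\<close>.  So everything rests on the initial derivative of \<open>\<Phi>\<close> along rays.

  The symbols are recovered from a single function, \<open>k(w) = 1 / (2 (w + 1))\<close>, which is injective
  with an explicit inverse.  Point evaluations are bounded on the Hardy space
  (\<open>hardy2_point_evaluation\<close>), so the norm hypotheses turn into pointwise statements: \<open>\<Phi> \<xi> z\<close> is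
  holomorphic in \<open>\<xi>\<close>, tends to \<open>z\<close> as \<open>\<xi>\<close> decreases to \<open>0\<close> through the reals, and obeys the
  semigroup law at real times.  Differentiability in operator norm at \<open>s > 0\<close> also places
  \<open>S s k\<close> in the domain of the generator, and the identity \<open>A f = G f'\<close> for this function
  becomes \<open>\<partial>\<^sub>s \<Phi> s z = G(z) \<cdot> \<partial>\<^sub>z \<Phi> s z\<close>.  These facts make up the locale
  \<open>analytic_semiflow\<close>.

  Inside it, Vitali's theorem (\<open>Vitali_bounded\<close>) gives \<open>\<partial>\<^sub>z \<Phi> s z \<longlongrightarrow> 1\<close> for real \<open>s \<rightarrow> 0\<close>, hence the
  derivative \<open>G(z)\<close> at real time \<open>0\<close>.  The identity theorem extends the semigroup law to
  \<open>\<Phi> (\<xi> + s) = \<Phi> s \<circ> \<Phi> \<xi>\<close> for complex \<open>\<xi>\<close>, and letting \<open>s \<rightarrow> 0\<close> yields the differential equation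
  \<open>\<partial>\<^sub>\<xi> \<Phi> \<xi> z = G(\<Phi> \<xi> z)\<close> on the whole cone.  Finally the rescaled functions \<open>\<xi> \<mapsto> \<Phi> (\<xi>/n) z\<close>
  converge to \<open>z\<close> at positive reals, hence by Vitali uniformly on the segment from \<open>1\<close> to a point
  \<open>e\<close> of the cone; integrating the differential equation along this segment carries the real
  derivative over to the ray through \<open>e\<close> (\<open>generator_along_ray\<close>).\<close>

section \<open>Functions in the Hardy space and difference quotients of operators\<close>

lemma right_half_plane_iff [simp]: "z \<in> right_half_plane \<longleftrightarrow> 0 < Re z"
  by (simp add: right_half_plane_def)

lemma open_right_half_plane [simp]: "open right_half_plane"
  unfolding right_half_plane_def by (rule open_halfspace_Re_gt)

lemma convex_right_half_plane [simp]: "convex right_half_plane"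
  unfolding right_half_plane_def by (rule convex_halfspace_Re_gt)

lemma hardy2_norm_nonneg [simp]: "0 \<le> hardy2_norm f"
  by (simp add: hardy2_norm_def)

lemma ennreal_hardy2_norm_sq:
  assumes "f \<in> hardy2"
  shows "ennreal ((hardy2_norm f)\<^sup>2) = hardy2_sq f"
  using assms by (simp add: hardy2_def hardy2_norm_def)

lemma hardy2_line_le:
  assumes "f \<in> hardy2" "0 < x"
  shows "(\<integral>\<^sup>+y. ennreal ((cmod (f (Complex x y)))\<^sup>2) \<partial>lborel) \<le> ennreal ((hardy2_norm f)\<^sup>2)"
  unfolding ennreal_hardy2_norm_sq [OF assms(1)] hardy2_sq_def
  by (rule SUP_upper) (use assms in auto)

lemma hardy2_continuous_on_line:
  assumes "f holomorphic_on right_half_plane" "0 < x"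
  shows "continuous_on A (\<lambda>y. f (Complex x y))"
proof (rule continuous_on_compose2 [OF holomorphic_on_imp_continuous_on [OF assms(1)]])
  show "continuous_on A (Complex x)"
    unfolding Complex_eq by (intro continuous_intros)
qed (use assms in auto)

lemma hardy2_segment:
  assumes "f \<in> hardy2" "0 < x"
  shows "(\<lambda>y. (cmod (f (Complex x y)))\<^sup>2) integrable_on {a..b}"
    and "integral {a..b} (\<lambda>y. (cmod (f (Complex x y)))\<^sup>2) \<le> (hardy2_norm f)\<^sup>2"
proof -
  let ?h = "\<lambda>y. (cmod (f (Complex x y)))\<^sup>2"
  have "continuous_on {a..b} ?h"
    using assms by (intro continuous_intros hardy2_continuous_on_line) (auto simp: hardy2_def)
  then show int: "?h integrable_on {a..b}"
    by (rule integrable_continuous_real)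
  have "ennreal (integral {a..b} ?h) = (\<integral>\<^sup>+y. ennreal (?h y) * indicator {a..b} y \<partial>lborel)"
    by (rule nn_integral_has_integral_lebesgue' [symmetric]) (use int in auto)
  also have "\<dots> \<le> (\<integral>\<^sup>+y. ennreal (?h y) \<partial>lborel)"
    by (intro nn_integral_mono) (auto simp: indicator_def)
  also have "\<dots> \<le> ennreal ((hardy2_norm f)\<^sup>2)"
    by (rule hardy2_line_le [OF assms])
  finally show "integral {a..b} ?h \<le> (hardy2_norm f)\<^sup>2"
    by (simp add: ennreal_le_iff)
qed

lemma Complex_has_vector_derivative_Im:
  "((\<lambda>t. Complex x t) has_vector_derivative \<i>) (at t within A)"
  using bounded_linear.has_vector_derivative [OF bounded_linear_of_real has_vector_derivative_id]
  unfolding Complex_eq by (auto intro!: derivative_eq_intros)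

lemma Complex_has_vector_derivative_Re:
  "((\<lambda>t. Complex t y) has_vector_derivative 1) (at t within A)"
  using bounded_linear.has_vector_derivative [OF bounded_linear_of_real has_vector_derivative_id]
  unfolding Complex_eq by (auto intro!: derivative_eq_intros)

lemma holomorphic_convex_open_primitive: 
  assumes "convex S" "open S" "f holomorphic_on S"
  shows "\<exists>F. \<forall>w\<in>S. (F has_field_derivative f w) (at w)"
proof (rule holomorphic_convex_primitive' [OF assms])
  fix g assume g: "\<And>x. x \<in> S \<Longrightarrow> (g has_field_derivative f x) (at x within S)"
  have "(g has_field_derivative f w) (at w)" if "w \<in> S" for w
    using g [OF that] unfolding at_within_open [OF that assms(2)] .
  then show ?thesis
    by blast
qed

text \<open>The average \<open>g(w) = \<integral>\<^sub>0\<^sup>d i f(w + it) dt\<close> is bounded by \<open>c\<close> on the half-plane, by the arithmetic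
  and geometric mean inequality, and \<open>g\<close> is a difference of values of a primitive of \<open>f\<close>.
  So its derivative is the increment of \<open>f\<close>, and Cauchy's estimate on a disc of radius
  \<open>Re z / 2\<close> bounds it.\<close>

lemma hardy2_vertical_shift:
  assumes f: "f \<in> hardy2" and c: "0 < c" "hardy2_norm f \<le> c"
    and z: "0 < Re z" and d: "0 \<le> d" "d \<le> 1"
  shows "cmod (f (z + \<i> * of_real d) - f z) \<le> 2 * c / Re z"
proof -
  have holf: "f holomorphic_on right_half_plane"
    using f by (simp add: hardy2_def)
  obtain F where F0: "\<forall>w\<in>right_half_plane. (F has_field_derivative f w) (at w)"
    using holomorphic_convex_open_primitive [OF convex_right_half_plane open_right_half_plane holf] ..
  have F: "(F has_field_derivative f w) (at w)" if "0 < Re w" for w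
    using F0 that by simp
  define g where "g = (\<lambda>w. F (w + \<i> * of_real d) - F w)"
  have g': "(g has_field_derivative f (w + \<i> * of_real d) - f w) (at w)" if "0 < Re w" for w
  proof -
    have "((\<lambda>w. F (w + \<i> * of_real d)) has_field_derivative f (w + \<i> * of_real d) * 1) (at w)"
      by (rule DERIV_chain2 [OF F]) (use that in \<open>auto intro!: derivative_eq_intros\<close>)
    from DERIV_diff [OF this F [OF that]] show ?thesis
      by (simp add: g_def)
  qed
  have holg: "g holomorphic_on right_half_plane"
    unfolding holomorphic_on_open [OF open_right_half_plane] using g' by (metis right_half_plane_iff)
  have g_le: "cmod (g w) \<le> c" if w: "0 < Re w" for w
  proof -
    let ?x = "Re w" and ?y = "Im w"
    have wE: "w = Complex ?x ?y" "w + \<i> * of_real d = Complex ?x (?y + d)"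
      by (auto simp: complex_eq_iff)
    have I: "((\<lambda>t. \<i> * f (Complex ?x t)) has_integral (F (Complex ?x (?y + d)) - F (Complex ?x ?y))) {?y..?y+d}"
    proof (rule fundamental_theorem_of_calculus)
      fix t
      from field_vector_diff_chain_within [OF Complex_has_vector_derivative_Im, of F "f (Complex ?x t)" ?x t "{?y..?y+d}"]
        F [of "Complex ?x t"] w
      show "((\<lambda>t. F (Complex ?x t)) has_vector_derivative \<i> * f (Complex ?x t)) (at t within {?y..?y+d})"
        by (simp add: o_def has_field_derivative_at_within)
    qed (use d in simp)
    let ?b = "\<lambda>t. c / 2 + (cmod (f (Complex ?x t)))\<^sup>2 / (2 * c)"
    have sq: "(\<lambda>y. (cmod (f (Complex ?x y)))\<^sup>2) integrable_on {?y..?y+d}"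
      "integral {?y..?y+d} (\<lambda>y. (cmod (f (Complex ?x y)))\<^sup>2) \<le> c\<^sup>2"
      using hardy2_segment [OF f w, of ?y "?y + d"] power_mono [OF c(2), of 2] by auto
    have J: "(?b has_integral d * (c / 2) + integral {?y..?y+d} (\<lambda>y. (cmod (f (Complex ?x y)))\<^sup>2) / (2 * c)) {?y..?y+d}"
      using has_integral_add [OF has_integral_const_real [of "c/2" ?y "?y + d"] has_integral_divide [OF integrable_integral [OF sq(1)], of "2 * c"]] d
      by simp
    have "cmod (g w) = cmod (integral {?y..?y+d} (\<lambda>t. \<i> * f (Complex ?x t)))"
      using integral_unique [OF I] unfolding g_def wE(2) by (simp flip: wE(1))
    also have "\<dots> \<le> integral {?y..?y+d} ?b"
    proof (rule integral_norm_bound_integral)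
      fix t
      \<comment> \<open>This square gives \<open>\<bar>f\<bar> \<le> (c + \<bar>f\<bar>\<^sup>2 / c) / 2\<close>.\<close>
      have "0 \<le> (cmod (f (Complex ?x t)) - c)\<^sup>2"
        by simp
      then show "cmod (\<i> * f (Complex ?x t)) \<le> ?b t"
        using c(1) by (simp add: norm_mult power2_eq_square field_simps)
    qed (use I J in auto)
    also have "\<dots> = d * (c / 2) + integral {?y..?y+d} (\<lambda>y. (cmod (f (Complex ?x y)))\<^sup>2) / (2 * c)"
      using J by (rule integral_unique)
    also have "\<dots> \<le> 1 * (c / 2) + c\<^sup>2 / (2 * c)"
      using d c sq(2) by (intro add_mono mult_right_mono divide_right_mono) auto
    also have "\<dots> = c"
      using c(1) by (simp add: power2_eq_square)
    finally show ?thesis .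
  qed
  have ball: "w \<in> right_half_plane" if "w \<in> cball z (Re z / 2)" for w
  proof -
    have "\<bar>Re (z - w)\<bar> \<le> Re z / 2"
      using that abs_Re_le_cmod [of "z - w"] by (simp add: dist_norm)
    then show ?thesis
      using z by (simp add: abs_if split: if_splits)
  qed
  have "cmod ((deriv ^^ 1) g z) \<le> fact 1 * c / (Re z / 2) ^ 1"
  proof (rule Cauchy_inequality)
    show "g holomorphic_on ball z (Re z / 2)"
      by (rule holomorphic_on_subset [OF holg]) (use ball in auto)
    show "continuous_on (cball z (Re z / 2)) g"
      by (rule holomorphic_on_imp_continuous_on [OF holomorphic_on_subset [OF holg]]) (use ball in auto)
    show "cmod (g w) \<le> c" if "cmod (z - w) = Re z / 2" for w
      using ball [of w] that by (intro g_le) (auto simp: dist_norm)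
  qed (use z in auto)
  then show ?thesis
    using DERIV_imp_deriv [OF g' [OF z]] z by (simp add: field_simps)
qed

text \<open>By the preceding lemma \<open>\<bar>f\<bar>\<close> stays above \<open>\<bar>f(z)\<bar> - 2c / Re z\<close> on a vertical segment of unit
  length starting at \<open>z\<close>, but the mean square of \<open>f\<close> over this segment is at most \<open>c\<^sup>2\<close>.\<close>

lemma hardy2_point_evaluation:
  assumes f: "f \<in> hardy2" and z: "0 < Re z"
  shows "cmod (f z) \<le> hardy2_norm f * (1 + 2 / Re z)"
proof -
  have bound: "cmod (f z) \<le> c * (1 + 2 / Re z)" if c: "0 < c" "hardy2_norm f \<le> c" for c
  proof (rule ccontr)
    assume "\<not> ?thesis"
    then have m: "c < cmod (f z) - 2 * c / Re z"
      by (simp add: algebra_simps)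
    let ?m = "cmod (f z) - 2 * c / Re z" and ?h = "\<lambda>y. (cmod (f (Complex (Re z) y)))\<^sup>2"
    have "?m\<^sup>2 = integral {Im z..Im z + 1} (\<lambda>y. ?m\<^sup>2)"
      by simp
    also have "\<dots> \<le> integral {Im z..Im z + 1} ?h"
    proof (rule integral_le)
      fix y assume y: "y \<in> {Im z..Im z + 1}"
      have "z + \<i> * of_real (y - Im z) = Complex (Re z) y"
        by (simp add: complex_eq_iff)
      then have "cmod (f (Complex (Re z) y) - f z) \<le> 2 * c / Re z"
        using hardy2_vertical_shift [OF f c z, of "y - Im z"] y by auto
      then have "?m \<le> cmod (f (Complex (Re z) y))"
        using norm_triangle_ineq2 [of "f z" "f (Complex (Re z) y)"] by (simp add: norm_minus_commute)
      then show "?m\<^sup>2 \<le> ?h y"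
        using m c by (intro power_mono) auto
    qed (use hardy2_segment(1) [OF f z] in auto)
    also have "\<dots> \<le> c\<^sup>2"
      using hardy2_segment(2) [OF f z, of "Im z" "Im z + 1"] power_mono [OF c(2), of 2] by simp
    finally have "?m \<le> c"
      using c by (simp add: power2_le_iff_abs_le)
    with m show False by simp
  qed
  \<comment> \<open>The bound needs \<open>c > 0\<close>, so a zero norm is reached as a limit.\<close>
  have "((\<lambda>e. (hardy2_norm f + e) * (1 + 2 / Re z)) \<longlongrightarrow> (hardy2_norm f + 0) * (1 + 2 / Re z)) (at_right 0)"
    by (intro tendsto_intros)
  moreover have "\<forall>\<^sub>F e in at_right 0. cmod (f z) \<le> (hardy2_norm f + e) * (1 + 2 / Re z)"
  proof (rule eventually_mono [OF eventually_at_right_less])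
    fix e :: real assume "0 < e"
    then show "cmod (f z) \<le> (hardy2_norm f + e) * (1 + 2 / Re z)"
      by (intro bound) (auto simp: add_nonneg_pos)
  qed
  ultimately show ?thesis
    using tendsto_lowerbound by fastforce
qed

lemma hardy2_cmult:
  assumes "f \<in> hardy2"
  shows "(\<lambda>z. c * f z) \<in> hardy2" and "hardy2_norm (\<lambda>z. c * f z) = cmod c * hardy2_norm f"
proof -
  have m: "(\<lambda>y. f (Complex x y)) \<in> borel_measurable borel" if "0 < x" for x
    using hardy2_continuous_on_line [of f x UNIV] assms that
    by (intro borel_measurable_continuous_onI) (auto simp: hardy2_def)
  have "hardy2_sq (\<lambda>z. c * f z) = (SUP x\<in>{0<..}. ennreal ((cmod c)\<^sup>2) * (\<integral>\<^sup>+y. ennreal ((cmod (f (Complex x y)))\<^sup>2) \<partial>lborel))"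
    unfolding hardy2_sq_def
    using m by (intro SUP_cong refl) (simp add: norm_mult power_mult_distrib ennreal_mult nn_integral_cmult)
  also have "\<dots> = ennreal ((cmod c)\<^sup>2) * hardy2_sq f"
    unfolding hardy2_sq_def by (simp add: SUP_mult_left_ennreal)
  finally have eq: "hardy2_sq (\<lambda>z. c * f z) = ennreal ((cmod c)\<^sup>2) * hardy2_sq f" .
  then show "(\<lambda>z. c * f z) \<in> hardy2"
    using assms by (auto simp: hardy2_def ennreal_mult_less_top intro!: holomorphic_intros)
  show "hardy2_norm (\<lambda>z. c * f z) = cmod c * hardy2_norm f"
    unfolding hardy2_norm_def eq by (simp add: enn2real_mult real_sqrt_mult)
qed

text \<open>The constant \<open>2\<close> in place of the triangle inequality comes from \<open>\<bar>a + b\<bar>\<^sup>2 \<le> 2\<bar>a\<bar>\<^sup>2 + 2\<bar>b\<bar>\<^sup>2\<close>.  It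
  suffices to see that sums of bounded operators are bounded.\<close>

lemma hardy2_add:
  assumes f: "f \<in> hardy2" and g: "g \<in> hardy2"
  shows "(\<lambda>z. f z + g z) \<in> hardy2"
    and "hardy2_norm (\<lambda>z. f z + g z) \<le> 2 * (hardy2_norm f + hardy2_norm g)"
proof -
  let ?a = "hardy2_norm f" and ?b = "hardy2_norm g"
  have m: "(\<lambda>y. h (Complex x y)) \<in> borel_measurable borel" if "0 < x" "h \<in> hardy2" for x h
    using hardy2_continuous_on_line [of h x UNIV] that
    by (intro borel_measurable_continuous_onI) (auto simp: hardy2_def)
  have le: "hardy2_sq (\<lambda>z. f z + g z) \<le> ennreal (2 * ?a\<^sup>2 + 2 * ?b\<^sup>2)"
    unfolding hardy2_sq_def
  proof (rule SUP_least)
    fix x :: real assume "x \<in> {0<..}"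
    then have x: "0 < x" by simp
    note [measurable] = m [OF x f] m [OF x g]
    have "(\<integral>\<^sup>+y. ennreal ((cmod (f (Complex x y) + g (Complex x y)))\<^sup>2) \<partial>lborel)
      \<le> (\<integral>\<^sup>+y. 2 * ennreal ((cmod (f (Complex x y)))\<^sup>2) + 2 * ennreal ((cmod (g (Complex x y)))\<^sup>2) \<partial>lborel)"
    proof (rule nn_integral_mono)
      fix y
      let ?p = "cmod (f (Complex x y))" and ?q = "cmod (g (Complex x y))"
      have "(cmod (f (Complex x y) + g (Complex x y)))\<^sup>2 \<le> (?p + ?q)\<^sup>2"
        by (intro power_mono norm_triangle_ineq) auto
      also have "\<dots> \<le> 2 * ?p\<^sup>2 + 2 * ?q\<^sup>2"
        using zero_le_power2 [of "?p - ?q"] by (simp add: power2_eq_square algebra_simps)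
      finally show "ennreal ((cmod (f (Complex x y) + g (Complex x y)))\<^sup>2) \<le> 2 * ennreal (?p\<^sup>2) + 2 * ennreal (?q\<^sup>2)"
        by (simp add: ennreal_leI flip: ennreal_plus ennreal_numeral ennreal_mult)
    qed
    also have "\<dots> = 2 * (\<integral>\<^sup>+y. ennreal ((cmod (f (Complex x y)))\<^sup>2) \<partial>lborel)
        + 2 * (\<integral>\<^sup>+y. ennreal ((cmod (g (Complex x y)))\<^sup>2) \<partial>lborel)"
      by (simp add: nn_integral_add nn_integral_cmult)
    also have "\<dots> \<le> 2 * ennreal (?a\<^sup>2) + 2 * ennreal (?b\<^sup>2)"
      by (intro add_mono mult_left_mono hardy2_line_le f g x) auto
    also have "\<dots> = ennreal (2 * ?a\<^sup>2 + 2 * ?b\<^sup>2)"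
      by (simp flip: ennreal_plus ennreal_numeral ennreal_mult)
    finally show "(\<integral>\<^sup>+y. ennreal ((cmod (f (Complex x y) + g (Complex x y)))\<^sup>2) \<partial>lborel)
      \<le> ennreal (2 * ?a\<^sup>2 + 2 * ?b\<^sup>2)" .
  qed
  then show mem: "(\<lambda>z. f z + g z) \<in> hardy2"
    using f g order_le_less_trans [OF le] by (auto simp: hardy2_def intro!: holomorphic_intros)
  have "(hardy2_norm (\<lambda>z. f z + g z))\<^sup>2 \<le> 2 * ?a\<^sup>2 + 2 * ?b\<^sup>2"
    using le unfolding ennreal_hardy2_norm_sq [OF mem, symmetric]
    by (subst (asm) ennreal_le_iff) auto
  also have "\<dots> \<le> (2 * (?a + ?b))\<^sup>2"
    by (simp add: power2_eq_square algebra_simps)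
  finally show "hardy2_norm (\<lambda>z. f z + g z) \<le> 2 * (?a + ?b)"
    by (rule power2_le_imp_le) simp
qed

lemma hardy2_diff:
  assumes f: "f \<in> hardy2" and g: "g \<in> hardy2"
  shows "(\<lambda>z. f z - g z) \<in> hardy2"
    and "hardy2_norm (\<lambda>z. f z - g z) \<le> 2 * (hardy2_norm f + hardy2_norm g)"
  using hardy2_add [OF f hardy2_cmult(1) [OF g, of "-1"]] hardy2_cmult(2) [OF g, of "-1"] by simp_all

text \<open>The operator norm is a supremum of reals, which is an upper bound only for a set that is
  bounded above; this is where boundedness of the operator enters.\<close>

lemma hardy2_norm_le_op_norm:
  assumes S: "\<And>f. f \<in> hardy2 \<Longrightarrow> hardy2_norm (S f) \<le> K * hardy2_norm f"
    and f: "f \<in> hardy2" "hardy2_norm f \<le> 1"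
  shows "hardy2_norm (S f) \<le> op_norm S"
  unfolding op_norm_def
proof (rule cSUP_upper)
  show "bdd_above ((\<lambda>f. hardy2_norm (S f)) ` {f \<in> hardy2. hardy2_norm f \<le> 1})"
  proof (rule bdd_aboveI2)
    fix h assume h: "h \<in> {f \<in> hardy2. hardy2_norm f \<le> 1}"
    have "hardy2_norm (S h) \<le> K * hardy2_norm h"
      using S h by simp
    also have "\<dots> \<le> \<bar>K\<bar> * 1"
      using h by (intro mult_mono) auto
    finally show "hardy2_norm (S h) \<le> \<bar>K\<bar> * 1" .
  qed
qed (use f in auto)

lemma difference_quotient_le_op_norm:
  assumes A: "bounded_op A" and B: "bounded_op B" and D: "bounded_op D"
    and f: "f \<in> hardy2" "hardy2_norm f \<le> 1"
  shows "(\<lambda>z. (A f z - B f z) / h - D f z) \<in> hardy2"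
    and "hardy2_norm (\<lambda>z. (A f z - B f z) / h - D f z)
           \<le> op_norm (\<lambda>f z. (A f z - B f z) / h - D f z)"
proof -
  obtain a b d where
    abd: "\<And>f. f \<in> hardy2 \<Longrightarrow> hardy2_norm (A f) \<le> a * hardy2_norm f"
         "\<And>f. f \<in> hardy2 \<Longrightarrow> hardy2_norm (B f) \<le> b * hardy2_norm f"
         "\<And>f. f \<in> hardy2 \<Longrightarrow> hardy2_norm (D f) \<le> d * hardy2_norm f"
    using A B D unfolding bounded_op_def by metis
  have mem: "A f \<in> hardy2" "B f \<in> hardy2" "D f \<in> hardy2" if "f \<in> hardy2" for f
    using A B D that by (auto simp: bounded_op_def)
  have quot: "(\<lambda>z. (A f z - B f z) / h) \<in> hardy2"
    "hardy2_norm (\<lambda>z. (A f z - B f z) / h) \<le> cmod (inverse h) * (2 * (a + b)) * hardy2_norm f"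
    if "f \<in> hardy2" for f
  proof -
    note AB = hardy2_diff [OF mem(1) [OF that] mem(2) [OF that]]
    show "(\<lambda>z. (A f z - B f z) / h) \<in> hardy2"
      using hardy2_cmult(1) [OF AB(1), of "inverse h"] by (simp add: field_simps)
    have "hardy2_norm (\<lambda>z. (A f z - B f z) / h) = cmod (inverse h) * hardy2_norm (\<lambda>z. A f z - B f z)"
      using hardy2_cmult(2) [OF AB(1), of "inverse h"] by (simp add: field_simps)
    also have "\<dots> \<le> cmod (inverse h) * (2 * (a * hardy2_norm f + b * hardy2_norm f))"
      using AB(2) abd(1,2) [OF that] by (intro mult_left_mono) auto
    finally show "hardy2_norm (\<lambda>z. (A f z - B f z) / h) \<le> cmod (inverse h) * (2 * (a + b)) * hardy2_norm f"
      by (simp add: algebra_simps)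
  qed
  show "(\<lambda>z. (A f z - B f z) / h - D f z) \<in> hardy2"
    by (rule hardy2_diff(1)) (use quot mem f in auto)
  show "hardy2_norm (\<lambda>z. (A f z - B f z) / h - D f z) \<le> op_norm (\<lambda>f z. (A f z - B f z) / h - D f z)"
  proof (rule hardy2_norm_le_op_norm [where K = "2 * (cmod (inverse h) * (2 * (a + b)) + d)", OF _ f])
    fix f assume f: "f \<in> hardy2"
    have "hardy2_norm (\<lambda>z. (A f z - B f z) / h - D f z)
        \<le> 2 * (hardy2_norm (\<lambda>z. (A f z - B f z) / h) + hardy2_norm (D f))"
      by (rule hardy2_diff(2)) (use quot mem f in auto)
    also have "\<dots> \<le> 2 * (cmod (inverse h) * (2 * (a + b)) * hardy2_norm f + d * hardy2_norm f)"
      using quot(2) [OF f] abd(3) [OF f] by simp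
    finally show "hardy2_norm (\<lambda>z. (A f z - B f z) / h - D f z)
        \<le> 2 * (cmod (inverse h) * (2 * (a + b)) + d) * hardy2_norm f"
      by (simp add: algebra_simps)
  qed
qed

text \<open>Up to a constant factor this is the reproducing kernel at the point \<open>1\<close>.  The factor keeps the
  norm below \<open>1\<close>, so that the operator norm applies to it directly.\<close>

definition test_function :: "complex \<Rightarrow> complex" where
  "test_function w = (if w \<in> right_half_plane then inverse (w + 1) / 2 else 0)"

lemma test_function_in_hardy2:
  shows "test_function \<in> hardy2" and "hardy2_norm test_function \<le> 1"
proof -
  have 1: "integrable lborel (\<lambda>y. inverse (1 + y\<^sup>2) :: real)" "(\<integral>y. inverse (1 + y\<^sup>2) \<partial>lborel) = (pi::real)"
    using integrable_inverse_1_plus_square LBINT_inverse_1_plus_square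
    by (simp_all add: set_integrable_def interval_lebesgue_integral_def set_lebesgue_integral_def einterval_def)
  have le: "hardy2_sq test_function \<le> ennreal (pi / 4)"
    unfolding hardy2_sq_def
  proof (rule SUP_least)
    fix x :: real assume "x \<in> {0<..}"
    then have x: "0 < x" by simp
    have "(\<integral>\<^sup>+y. ennreal ((cmod (test_function (Complex x y)))\<^sup>2) \<partial>lborel)
        \<le> (\<integral>\<^sup>+y. ennreal (1/4 * inverse (1 + y\<^sup>2)) \<partial>lborel)"
    proof (intro nn_integral_mono ennreal_leI)
      fix y
      have "(cmod (test_function (Complex x y)))\<^sup>2 = 1/4 * inverse ((x + 1)\<^sup>2 + y\<^sup>2)"
        using x by (simp add: test_function_def norm_divide norm_inverse power_divide power_inverse cmod_power2)
      also have "\<dots> \<le> 1/4 * inverse (1 + y\<^sup>2)"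
      proof -
        have "0 < 1 + y\<^sup>2" by (simp add: add_pos_nonneg)
        then show ?thesis
          using x by (intro mult_left_mono le_imp_inverse_le) (auto simp: power2_eq_square algebra_simps)
      qed
      finally show "(cmod (test_function (Complex x y)))\<^sup>2 \<le> 1/4 * inverse (1 + y\<^sup>2)" .
    qed
    also have "\<dots> = ennreal (\<integral>y. 1/4 * inverse (1 + y\<^sup>2) \<partial>lborel)"
      using 1(1) by (intro nn_integral_eq_integral) auto
    also have "\<dots> = ennreal (pi / 4)"
      using 1 by simp
    finally show "(\<integral>\<^sup>+y. ennreal ((cmod (test_function (Complex x y)))\<^sup>2) \<partial>lborel) \<le> ennreal (pi / 4)" .
  qed
  have "test_function holomorphic_on right_half_plane \<longleftrightarrow> (\<lambda>w. inverse (w + 1) / 2) holomorphic_on right_half_plane"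
    by (intro holomorphic_cong) (auto simp: test_function_def)
  moreover have "(\<lambda>w. inverse (w + 1) / 2) holomorphic_on right_half_plane"
    by (intro holomorphic_intros) (auto simp: complex_eq_iff)
  ultimately show mem: "test_function \<in> hardy2"
    using le order_le_less_trans [OF le] by (auto simp: hardy2_def test_function_def)
  have "(hardy2_norm test_function)\<^sup>2 \<le> pi / 4"
    using le unfolding ennreal_hardy2_norm_sq [OF mem, symmetric] by (simp add: ennreal_le_iff)
  also have "\<dots> \<le> 1\<^sup>2"
    using pi_less_4 by simp
  finally show "hardy2_norm test_function \<le> 1"
    by (rule power2_le_imp_le) simp
qed

section \<open>Self-maps of the half-plane and bounded holomorphic sequences\<close>

text \<open>The Schwarz lemma applied to \<open>d \<circ> \<phi> \<circ> c\<close>, where the Moebius map \<open>c\<close> takes the disc to the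
  half-plane and \<open>0\<close> to \<open>z\<close>, and \<open>d\<close> takes the half-plane to the disc and \<open>\<phi>(z)\<close> to \<open>0\<close>.\<close>

lemma Schwarz_Pick_half_plane:
  assumes hol: "\<phi> holomorphic_on right_half_plane"
    and maps: "\<phi> ` right_half_plane \<subseteq> right_half_plane" and z: "0 < Re z"
  shows "cmod (deriv \<phi> z) * Re z \<le> Re (\<phi> z)"
proof -
  define w where "w = \<phi> z"
  have w: "0 < Re w"
    using maps z by (auto simp: w_def image_subset_iff)
  define c where "c = (\<lambda>u. (z + cnj z * u) / (1 - u))"
  define d where "d = (\<lambda>v. (v - w) / (v + cnj w))"
  have c_pos: "0 < Re (c u)" if u: "cmod u < 1" for u
  proof -
    have "u \<noteq> 1" using u by auto
    then have nz: "0 < (cmod (1 - u))\<^sup>2" by simp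
    have "c u = (z + cnj z * u) * cnj (1 - u) / of_real ((cmod (1 - u))\<^sup>2)"
      unfolding c_def by (subst complex_div_cnj) simp
    then have "Re (c u) = Re ((z + cnj z * u) * cnj (1 - u)) / (cmod (1 - u))\<^sup>2"
      by (simp del: of_real_power)
    also have "Re ((z + cnj z * u) * cnj (1 - u)) = Re z * (1 - (cmod u)\<^sup>2)"
      unfolding cmod_power2 by (simp add: power2_eq_square algebra_simps)
    finally have "Re (c u) = Re z * (1 - (cmod u)\<^sup>2) / (cmod (1 - u))\<^sup>2" .
    moreover have "(cmod u)\<^sup>2 < 1"
      using u by (simp add: power_less_one_iff)
    ultimately show ?thesis
      using nz z by simp
  qed
  have d_lt: "cmod (d v) < 1" and d_nz: "v + cnj w \<noteq> 0" if v: "0 < Re v" for v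
  proof -
    have "0 < Re (v + cnj w)" using v w by simp
    then show nz: "v + cnj w \<noteq> 0" by (metis less_irrefl zero_complex.simps(1))
    have "(cmod (v - w))\<^sup>2 < (cmod (v + cnj w))\<^sup>2"
      using mult_pos_pos [OF v w] unfolding cmod_power2 by (simp add: power2_eq_square algebra_simps)
    then have "cmod (v - w) < cmod (v + cnj w)"
      by (rule power2_less_imp_less) simp
    then show "cmod (d v) < 1"
      using nz by (simp add: d_def norm_divide)
  qed
  define g where "g = (\<lambda>u. d (\<phi> (c u)))"
  have \<phi>': "(\<phi> has_field_derivative deriv \<phi> v) (at v)" if "0 < Re v" for v
    using holomorphic_derivI [OF hol open_right_half_plane] that by simp
  have c': "(c has_field_derivative (cnj z * (1 - u) + (z + cnj z * u)) / (1 - u)\<^sup>2) (at u)" if "cmod u < 1" for u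
    unfolding c_def using that by (auto intro!: derivative_eq_intros simp: power2_eq_square)
  have d': "(d has_field_derivative ((v + cnj w) - (v - w)) / (v + cnj w)\<^sup>2) (at v)" if "0 < Re v" for v
    unfolding d_def using d_nz [OF that] by (auto intro!: derivative_eq_intros simp: power2_eq_square)
  have \<phi>_pos: "0 < Re (\<phi> (c u))" if "cmod u < 1" for u
    using maps c_pos [OF that] by (auto simp: image_subset_iff)
  have g': "(g has_field_derivative
      ((\<phi> (c u) + cnj w) - (\<phi> (c u) - w)) / (\<phi> (c u) + cnj w)\<^sup>2 *
      (deriv \<phi> (c u) * ((cnj z * (1 - u) + (z + cnj z * u)) / (1 - u)\<^sup>2))) (at u)" if "cmod u < 1" for u
    unfolding g_def
    by (rule DERIV_chain2 [OF d' DERIV_chain2 [OF \<phi>' c']]) (use that \<phi>_pos c_pos in auto)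
  have "cmod (deriv g 0) \<le> 1"
  proof (rule Schwarz_Lemma(2) [where \<xi> = 0])
    show "g holomorphic_on ball 0 1"
      unfolding holomorphic_on_open [OF open_ball] using g' by (metis mem_ball_0)
    show "g 0 = 0"
      by (simp add: g_def d_def c_def w_def)
    show "cmod (g u) < 1" if "cmod u < 1" for u
      unfolding g_def by (rule d_lt [OF \<phi>_pos [OF that]])
  qed simp
  moreover have "deriv g 0 = (w + cnj w) / (w + cnj w)\<^sup>2 * (deriv \<phi> z * (cnj z + z))"
    using DERIV_imp_deriv [OF g' [of 0]] by (simp add: c_def w_def add.commute)
  moreover have "w + cnj w = of_real (2 * Re w)" "cnj z + z = of_real (2 * Re z)"
    by (auto simp: complex_eq_iff)
  ultimately have "cmod (of_real (2 * Re w) / (of_real (2 * Re w))\<^sup>2 * (deriv \<phi> z * of_real (2 * Re z))) \<le> 1"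
    by simp
  then show ?thesis
    using w z unfolding w_def by (simp add: norm_mult norm_divide norm_power power2_eq_square field_simps)
qed

lemma Re_over_x_antimono:
  assumes hol: "\<phi> holomorphic_on right_half_plane"
    and maps: "\<phi> ` right_half_plane \<subseteq> right_half_plane"
    and x: "0 < x" "x \<le> x'"
  shows "Re (\<phi> (Complex x' y)) / x' \<le> Re (\<phi> (Complex x y)) / x"
proof (rule DERIV_nonpos_imp_nonincreasing [OF x(2)])
  fix t assume "x \<le> t" "t \<le> x'"
  then have t: "0 < t" using x by simp
  have "(\<phi> has_field_derivative deriv \<phi> (Complex t y)) (at (Complex t y))"
    using holomorphic_derivI [OF hol open_right_half_plane, of "Complex t y"] t by simp
  from field_vector_diff_chain_at [OF Complex_has_vector_derivative_Re this]
  have "((\<lambda>t. \<phi> (Complex t y)) has_vector_derivative deriv \<phi> (Complex t y)) (at t)"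
    unfolding o_def mult_1_left .
  from bounded_linear.has_vector_derivative [OF bounded_linear_Re this]
  have Re': "((\<lambda>t. Re (\<phi> (Complex t y))) has_real_derivative Re (deriv \<phi> (Complex t y))) (at t)"
    unfolding has_real_derivative_iff_has_vector_derivative .
  then have "((\<lambda>t. Re (\<phi> (Complex t y)) / t) has_real_derivative
      (Re (deriv \<phi> (Complex t y)) * t - Re (\<phi> (Complex t y))) / (t * t)) (at t)"
    using DERIV_divide [OF Re' DERIV_ident] t by simp
  moreover have "Re (deriv \<phi> (Complex t y)) * t \<le> Re (\<phi> (Complex t y))"
  proof (rule order_trans)
    show "Re (deriv \<phi> (Complex t y)) * t \<le> cmod (deriv \<phi> (Complex t y)) * t"
      using t by (intro mult_right_mono complex_Re_le_cmod) auto
    show "cmod (deriv \<phi> (Complex t y)) * t \<le> Re (\<phi> (Complex t y))"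
      using Schwarz_Pick_half_plane [OF hol maps, of "Complex t y"] t by simp
  qed
  ultimately show "\<exists>y'. ((\<lambda>t. Re (\<phi> (Complex t y)) / t) has_real_derivative y') (at t) \<and> y' \<le> 0"
    using t by (meson diff_le_0_iff_le divide_nonpos_pos mult_pos_pos)
qed

text \<open>If the convergence were not uniform, Montel's theorem would give a limit of a bad subsequence;
  by the identity theorem this limit is \<open>g\<close>, because it agrees with \<open>g\<close> on \<open>E\<close>.\<close>

lemma Vitali_bounded:
  fixes f :: "nat \<Rightarrow> complex \<Rightarrow> complex"
  assumes U: "open U" "connected U"
    and hol: "\<And>n. f n holomorphic_on U" and holg: "g holomorphic_on U"
    and bdd: "\<And>n z. z \<in> U \<Longrightarrow> cmod (f n z) \<le> B"
    and E: "E \<subseteq> U" "a \<in> U" "a islimpt E"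
    and lim: "\<And>z. z \<in> E \<Longrightarrow> (\<lambda>n. f n z) \<longlonglongrightarrow> g z"
    and K: "compact K" "K \<subseteq> U"
  shows "uniform_limit K f g sequentially"
proof (rule ccontr)
  assume "\<not> uniform_limit K f g sequentially"
  then obtain e where e: "0 < e" "\<exists>\<^sub>F n in sequentially. \<exists>z\<in>K. e \<le> dist (f n z) (g z)"
    unfolding uniform_limit_iff frequently_def by (auto simp: not_less Bex_def Ball_def not_le)
  then have inf: "infinite {n. \<exists>z\<in>K. e \<le> dist (f n z) (g z)}"
    by (simp add: frequently_sequentially infinite_nat_iff_unbounded_le)
  define s where "s = enumerate {n. \<exists>z\<in>K. e \<le> dist (f n z) (g z)}"
  have s: "strict_mono s"
    unfolding s_def by (rule strict_mono_enumerate [OF inf])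
  have bad: "\<exists>z\<in>K. e \<le> dist (f (s n) z) (g z)" for n
    using enumerate_in_set [OF inf, of n] by (simp add: s_def)
  obtain h r where h: "h holomorphic_on U" and r: "strict_mono r"
    and ptw: "\<And>z. z \<in> U \<Longrightarrow> (\<lambda>n. f (s (r n)) z) \<longlonglongrightarrow> h z"
    and unif: "\<And>K. \<lbrakk>compact K; K \<subseteq> U\<rbrakk> \<Longrightarrow> uniform_limit K ((\<lambda>n. f (s n)) \<circ> r) h sequentially"
  proof (rule Montel [of U "range f" "\<lambda>n. f (s n)"])
    show "\<exists>B. \<forall>h\<in>range f. \<forall>z\<in>K. cmod (h z) \<le> B" if "K \<subseteq> U" for K
      using that bdd by blast
  qed (use U hol in auto)
  have "h z = g z" if z: "z \<in> E" for z
  proof (rule LIMSEQ_unique)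
    show "(\<lambda>n. f (s (r n)) z) \<longlonglongrightarrow> h z"
      using ptw z E by blast
    show "(\<lambda>n. f (s (r n)) z) \<longlonglongrightarrow> g z"
      using LIMSEQ_subseq_LIMSEQ [OF lim [OF z] strict_mono_o [OF s r]] by (simp add: o_def)
  qed
  then have "h z - g z = 0" if "z \<in> U" for z
    using analytic_continuation [of "\<lambda>z. h z - g z" U E a z] U h holg E that
    by (auto intro: holomorphic_on_diff)
  then have eq: "h z = g z" if "z \<in> U" for z
    using that by simp
  have "\<forall>\<^sub>F n in sequentially. \<forall>z\<in>K. dist (((\<lambda>n. f (s n)) \<circ> r) n z) (h z) < e"
    using unif [OF K] e(1) by (simp add: uniform_limit_iff)
  then obtain n where "\<forall>z\<in>K. dist (f (s (r n)) z) (h z) < e"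
    by (auto simp: eventually_sequentially)
  moreover obtain z where "z \<in> K" "e \<le> dist (f (s (r n)) z) (g z)"
    using bad by blast
  ultimately show False
    using eq [of z] K(2)
    by (metis leD subsetD)
qed

section \<open>Holomorphic semiflows with times in a cone\<close>

text \<open>The open sector of half-angle \<open>arctan \<kappa>\<close>.  The description by linear inequalities makes openness,
  convexity and stability under real translations immediate.\<close>

definition aperture_cone :: "real \<Rightarrow> complex set" where
  "aperture_cone \<kappa> = {\<xi>. \<bar>Im \<xi>\<bar> < \<kappa> * Re \<xi>}"

lemma open_aperture_cone: "open (aperture_cone \<kappa>)"
  unfolding aperture_cone_def by (intro open_Collect_less continuous_intros)

lemma convex_aperture_cone: "convex (aperture_cone \<kappa>)"
proof -
  have "aperture_cone \<kappa> = {\<xi>. (Complex (- \<kappa>) 1) \<bullet> \<xi> < 0} \<inter> {\<xi>. (Complex (- \<kappa>) (- 1)) \<bullet> \<xi> < 0}"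
    by (auto simp: aperture_cone_def inner_complex_def abs_less_iff)
  then show ?thesis
    by (auto intro!: convex_Int convex_halfspace_lt)
qed

lemma of_real_in_cone: "0 < \<kappa> \<Longrightarrow> 0 < s \<Longrightarrow> of_real s \<in> aperture_cone \<kappa>"
  by (simp add: aperture_cone_def)

lemma cone_add_real:
  assumes "0 < \<kappa>" "\<xi> \<in> aperture_cone \<kappa>" "0 < s"
  shows "\<xi> + of_real s \<in> aperture_cone \<kappa>"
proof -
  have "\<bar>Im \<xi>\<bar> + 0 < \<kappa> * Re \<xi> + \<kappa> * s"
    using assms by (intro add_strict_mono mult_pos_pos) (auto simp: aperture_cone_def)
  then show ?thesis
    by (simp add: aperture_cone_def distrib_left)
qed

lemma cone_scale: "\<xi> \<in> aperture_cone \<kappa> \<Longrightarrow> 0 < r \<Longrightarrow> \<xi> / of_real r \<in> aperture_cone \<kappa>"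
  using divide_strict_right_mono [of "\<bar>Im \<xi>\<bar>" "\<kappa> * Re \<xi>" r] by (simp add: aperture_cone_def abs_divide)

lemma cis_in_cone:
  assumes "\<bar>\<theta>\<bar> < \<beta>" "\<beta> < pi / 2"
  shows "cis \<theta> \<in> aperture_cone (tan \<beta>)"
proof -
  have c: "0 < cos \<theta>"
    using assms by (intro cos_gt_zero_pi) auto
  have "tan \<theta> < tan \<beta>"
    by (rule tan_monotone) (use assms in auto)
  moreover have "tan (- \<theta>) < tan \<beta>"
    by (rule tan_monotone) (use assms in auto)
  ultimately have "\<bar>tan \<theta>\<bar> < tan \<beta>"
    by (simp add: abs_less_iff)
  with c have "\<bar>tan \<theta>\<bar> * cos \<theta> < tan \<beta> * cos \<theta>"
    by simp
  then show ?thesis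
    using c by (simp add: aperture_cone_def tan_def abs_divide)
qed

lemma cone_subset_sector:
  assumes "0 < \<beta>" "\<beta> < pi / 2" "\<beta> \<le> \<theta>"
  shows "aperture_cone (tan \<beta>) \<subseteq> sector \<theta> - {0}"
proof
  fix \<xi> assume \<xi>: "\<xi> \<in> aperture_cone (tan \<beta>)"
  have t: "0 < tan \<beta>"
    using assms by (intro tan_gt_zero) auto
  have "0 < tan \<beta> * Re \<xi>"
    using \<xi> by (simp add: aperture_cone_def order_le_less_trans [OF abs_ge_zero])
  then have Re: "0 < Re \<xi>"
    using t by (simp add: zero_less_mult_iff)
  have "\<bar>Im \<xi> / Re \<xi>\<bar> < tan \<beta>"
    using \<xi> Re by (simp add: aperture_cone_def abs_divide divide_less_eq)
  then have "arctan (Im \<xi> / Re \<xi>) < arctan (tan \<beta>)" "arctan (- (Im \<xi> / Re \<xi>)) < arctan (tan \<beta>)"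
    by (auto simp only: arctan_less_iff)
  moreover have "arctan (tan \<beta>) = \<beta>"
    using assms by (intro arctan_tan) auto
  ultimately have "\<bar>Arg \<xi>\<bar> < \<theta>"
    using assms arg_conv_arctan [OF Re] by (simp add: arctan_minus abs_less_iff)
  moreover have "\<xi> = of_real (cmod \<xi>) * cis (Arg \<xi>)"
    using rcis_cmod_Arg [of \<xi>] by (simp add: rcis_def)
  ultimately have "\<xi> \<in> sector \<theta>"
    unfolding sector_def by (blast intro: norm_ge_zero)
  with Re show "\<xi> \<in> sector \<theta> - {0}"
    by auto
qed

text \<open>The consequences of the hypotheses for the symbols alone.  The semigroup law is assumed only at
  real times, and \<open>transport\<close> is the form in which the generator is known: it moves the time
  derivative to the initial point \<open>z\<close> instead of the end point \<open>\<Phi> s z\<close>.\<close>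

locale analytic_semiflow =
  fixes \<kappa> :: real and \<Phi> :: "complex \<Rightarrow> complex \<Rightarrow> complex" and G :: "complex \<Rightarrow> complex"
  assumes \<kappa>: "0 < \<kappa>"
    and hol_space: "\<xi> \<in> aperture_cone \<kappa> \<Longrightarrow> \<Phi> \<xi> holomorphic_on right_half_plane"
    and maps: "\<xi> \<in> aperture_cone \<kappa> \<Longrightarrow> 0 < Re z \<Longrightarrow> 0 < Re (\<Phi> \<xi> z)"
    and hol_time: "0 < Re z \<Longrightarrow> (\<lambda>\<xi>. \<Phi> \<xi> z) holomorphic_on aperture_cone \<kappa>"
    and semigroup: "0 < s \<Longrightarrow> 0 < t \<Longrightarrow> 0 < Re z \<Longrightarrow>
      \<Phi> (of_real (t + s)) z = \<Phi> (of_real s) (\<Phi> (of_real t) z)"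
    and continuous_at_0: "0 < Re z \<Longrightarrow> ((\<lambda>t. \<Phi> (of_real t) z) \<longlongrightarrow> z) (at_right 0)"
    and transport: "0 < s \<Longrightarrow> 0 < Re z \<Longrightarrow>
      deriv (\<lambda>\<xi>. \<Phi> \<xi> z) (of_real s) = G z * deriv (\<Phi> (of_real s)) z"
    and hol_G: "G holomorphic_on right_half_plane"
begin

lemma real_in_cone [simp]: "0 < s \<Longrightarrow> of_real s \<in> aperture_cone \<kappa>"
  by (rule of_real_in_cone [OF \<kappa>])

lemma plus_1_nonzero: "0 < Re w \<Longrightarrow> w + 1 \<noteq> 0"
  by (metis add_pos_pos less_irrefl one_complex.simps(1) plus_complex.simps(1) zero_complex.simps(1) zero_less_one)

lemma inverse_plus_1_le: "0 < Re w \<Longrightarrow> cmod (inverse (w + 1)) \<le> 1"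
  using abs_Re_le_cmod [of "w + 1"] by (simp add: norm_inverse inverse_le_1_iff)

text \<open>The maps \<open>\<Phi> s\<close> tend pointwise to the identity.  Their transforms \<open>1 / (\<Phi> s + 1)\<close> are bounded by
  \<open>1\<close>, so they converge locally uniformly, and so do the derivatives.\<close>

lemma spatial_deriv_tendsto_1:
  assumes z: "0 < Re z"
  shows "((\<lambda>s. deriv (\<Phi> (of_real s)) z) \<longlongrightarrow> 1) (at_right 0)"
  unfolding tendsto_at_iff_sequentially
proof (intro allI impI)
  fix X :: "nat \<Rightarrow> real"
  assume "\<forall>i. X i \<in> {0<..} - {0}" and X0: "X \<longlonglongrightarrow> 0"
  then have X: "0 < X i" for i by auto
  define f where "f = (\<lambda>n w. inverse (\<Phi> (of_real (X n)) w + 1))"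
  have hol_f: "f n holomorphic_on right_half_plane" for n
    unfolding f_def using X maps plus_1_nonzero by (auto intro!: holomorphic_intros hol_space)
  have ball: "cball z (Re z / 2) \<subseteq> right_half_plane"
  proof
    fix w assume "w \<in> cball z (Re z / 2)"
    then have "\<bar>Re (z - w)\<bar> \<le> Re z / 2"
      using abs_Re_le_cmod [of "z - w"] by (simp add: dist_norm)
    then show "w \<in> right_half_plane"
      using z by (simp add: abs_if split: if_splits)
  qed
  have lim: "(\<lambda>n. \<Phi> (of_real (X n)) w) \<longlonglongrightarrow> w" if "0 < Re w" for w
    using continuous_at_0 [OF that] X X0 unfolding tendsto_at_iff_sequentially by (simp add: o_def)
  have "uniform_limit (cball z (Re z / 2)) f (\<lambda>w. inverse (w + 1)) sequentially"
  proof (rule Vitali_bounded [where U = right_half_plane and E = right_half_plane and a = z and B = 1])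
    show "z islimpt right_half_plane"
      using z by (intro interior_limit_point) (simp add: interior_open)
    show "(\<lambda>n. f n w) \<longlonglongrightarrow> inverse (w + 1)" if "w \<in> right_half_plane" for w
      unfolding f_def using that lim plus_1_nonzero by (auto intro!: tendsto_intros)
    show "cmod (f n w) \<le> 1" if "w \<in> right_half_plane" for n w
      unfolding f_def using that X maps by (intro inverse_plus_1_le) auto
    show "(\<lambda>w. inverse (w + 1)) holomorphic_on right_half_plane"
      using plus_1_nonzero by (auto intro!: holomorphic_intros)
  qed (use hol_f ball z convex_connected [OF convex_right_half_plane] in auto)
  then have lim': "(\<lambda>n. deriv (f n) z) \<longlonglongrightarrow> deriv (\<lambda>w. inverse (w + 1)) z"
  proof (intro deriv_complex_uniform_limit [where A = "ball z (Re z / 2)"])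
    assume "uniform_limit (cball z (Re z / 2)) f (\<lambda>w. inverse (w + 1)) sequentially"
    then show "uniform_limit (ball z (Re z / 2)) f (\<lambda>w. inverse (w + 1)) sequentially"
      by (rule uniform_limit_on_subset) auto
    show "\<forall>\<^sub>F n in sequentially. f n holomorphic_on ball z (Re z / 2)"
      using hol_f ball by (intro always_eventually allI) (meson ball_subset_cball holomorphic_on_subset order_trans)
  qed (use z in auto)
  have "deriv (\<lambda>w. inverse (w + 1)) z = - inverse ((z + 1)\<^sup>2)"
    using plus_1_nonzero [OF z] by (intro DERIV_imp_deriv) (auto intro!: derivative_eq_intros simp: power2_eq_square)
  note lim' = lim' [unfolded this]
  have "(\<lambda>n. - ((\<Phi> (of_real (X n)) z + 1)\<^sup>2) * deriv (f n) z) \<longlonglongrightarrow> - ((z + 1)\<^sup>2) * - inverse ((z + 1)\<^sup>2)"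
    by (intro tendsto_mult tendsto_minus tendsto_power tendsto_add tendsto_const lim lim' z)
  moreover have "- ((\<Phi> (of_real (X n)) z + 1)\<^sup>2) * deriv (f n) z = deriv (\<Phi> (of_real (X n))) z" for n
  proof -
    have "(\<Phi> (of_real (X n)) has_field_derivative deriv (\<Phi> (of_real (X n))) z) (at z)"
      using holomorphic_derivI [OF hol_space open_right_half_plane] X z by simp
    then have "(f n has_field_derivative - (deriv (\<Phi> (of_real (X n))) z / (\<Phi> (of_real (X n)) z + 1)\<^sup>2)) (at z)"
      unfolding f_def using plus_1_nonzero [OF maps [OF real_in_cone [OF X] z]]
      by (auto intro!: derivative_eq_intros simp: power2_eq_square field_simps)
    then show ?thesis
      using plus_1_nonzero [OF maps [OF real_in_cone [OF X] z], of n] by (simp add: DERIV_imp_deriv)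
  qed
  ultimately show "((\<lambda>s. deriv (\<Phi> (of_real s)) z) \<circ> X) \<longlonglongrightarrow> 1"
    using plus_1_nonzero [OF z] by (simp add: o_def)
qed

lemma time_derivative:
  assumes "\<xi> \<in> aperture_cone \<kappa>" "0 < Re z"
  shows "((\<lambda>\<xi>. \<Phi> \<xi> z) has_field_derivative deriv (\<lambda>\<xi>. \<Phi> \<xi> z) \<xi>) (at \<xi>)"
  using holomorphic_derivI [OF hol_time [OF assms(2)] open_aperture_cone assms(1)] .

text \<open>At real times \<open>s > 0\<close> the time derivative is \<open>G(z) \<cdot> \<partial>\<^sub>z \<Phi> s z\<close>, which tends to \<open>G(z)\<close>; the mean value
  inequality on \<open>[r, s]\<close> with \<open>r \<rightarrow> 0\<close> gives the derivative at \<open>0\<close>.\<close>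

lemma real_generator:
  assumes z: "0 < Re z"
  shows "((\<lambda>s. (\<Phi> (of_real s) z - z) / of_real s) \<longlongrightarrow> G z) (at_right 0)"
proof (rule tendstoI)
  fix e :: real assume e: "0 < e"
  have "((\<lambda>s. deriv (\<lambda>\<xi>. \<Phi> \<xi> z) (of_real s)) \<longlongrightarrow> G z) (at_right 0)"
  proof (rule Lim_transform_eventually)
    show "((\<lambda>s. G z * deriv (\<Phi> (of_real s)) z) \<longlongrightarrow> G z) (at_right 0)"
      using tendsto_mult [OF tendsto_const [of "G z"] spatial_deriv_tendsto_1 [OF z]] by simp
    show "\<forall>\<^sub>F s in at_right 0. G z * deriv (\<Phi> (of_real s)) z = deriv (\<lambda>\<xi>. \<Phi> \<xi> z) (of_real s)"
      using eventually_at_right_less [of 0] by eventually_elim (simp add: transport z)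
  qed
  then have "\<forall>\<^sub>F s in at_right 0. dist (deriv (\<lambda>\<xi>. \<Phi> \<xi> z) (of_real s)) (G z) < e / 2"
    using e by (intro tendstoD) auto
  then obtain d where d: "0 < d"
    and close: "\<And>s. 0 < s \<Longrightarrow> s < d \<Longrightarrow> dist (deriv (\<lambda>\<xi>. \<Phi> \<xi> z) (of_real s)) (G z) < e / 2"
    by (auto simp: eventually_at_right_field)
  define h where "h = (\<lambda>s. \<Phi> (of_real s) z - of_real s * G z)"
  have h': "(h has_vector_derivative deriv (\<lambda>\<xi>. \<Phi> \<xi> z) (of_real s) - G z) (at s)" if "0 < s" for s
  proof -
    have "((\<lambda>\<xi>. \<Phi> \<xi> z - \<xi> * G z) has_field_derivative deriv (\<lambda>\<xi>. \<Phi> \<xi> z) (of_real s) - G z) (at (of_real s))"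
      using time_derivative [OF real_in_cone [OF that] z] by (auto intro!: derivative_eq_intros)
    from has_vector_derivative_real_field [OF this] show ?thesis
      unfolding h_def .
  qed
  have lip: "cmod (h s - h r) \<le> e / 2 * (s - r)" if "0 < r" "r < s" "s < d" for r s
  proof -
    have "\<exists>x\<in>{r<..<s}. cmod (h s - h r) \<le> cmod ((s - r) *\<^sub>R (deriv (\<lambda>\<xi>. \<Phi> \<xi> z) (of_real x) - G z))"
    proof (rule mvt_general [OF \<open>r < s\<close>])
      show "continuous_on {r..s} h"
        by (rule continuous_at_imp_continuous_on, rule ballI, rule has_vector_derivative_continuous [OF h'])
          (use that in auto)
      show "(h has_derivative (\<lambda>u. u *\<^sub>R (deriv (\<lambda>\<xi>. \<Phi> \<xi> z) (of_real x) - G z))) (at x)" if "r < x" "x < s" for x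
        using h' [of x] that \<open>0 < r\<close> by (simp add: has_vector_derivative_def)
    qed
    then obtain x where x: "r < x" "x < s"
      and le: "cmod (h s - h r) \<le> (s - r) * cmod (deriv (\<lambda>\<xi>. \<Phi> \<xi> z) (of_real x) - G z)"
      using that by auto
    have "cmod (deriv (\<lambda>\<xi>. \<Phi> \<xi> z) (of_real x) - G z) \<le> e / 2"
      using close [of x] x that by (simp add: dist_norm less_imp_le)
    then have "(s - r) * cmod (deriv (\<lambda>\<xi>. \<Phi> \<xi> z) (of_real x) - G z) \<le> (s - r) * (e / 2)"
      using that by (intro mult_left_mono) auto
    with le show ?thesis
      by (simp add: mult.commute)
  qed
  have h0: "(h \<longlongrightarrow> z) (at_right 0)"
  proof -
    have "((\<lambda>s::real. complex_of_real s) \<longlongrightarrow> of_real 0) (at_right 0)"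
      by (intro tendsto_intros)
    from tendsto_diff [OF continuous_at_0 [OF z] tendsto_mult [OF this tendsto_const]]
    show ?thesis
      unfolding h_def by simp
  qed
  have bound: "cmod (h s - z) \<le> e / 2 * s" if s: "0 < s" "s < d" for s
  proof (rule tendsto_le [where F = "at_right (0::real)"])
    show "((\<lambda>r. cmod (h s - h r)) \<longlongrightarrow> cmod (h s - z)) (at_right 0)"
      by (intro tendsto_intros h0)
    have "((\<lambda>r. e / 2 * (s - r)) \<longlongrightarrow> e / 2 * (s - 0)) (at_right 0)"
      by (intro tendsto_intros)
    then show "((\<lambda>r. e / 2 * (s - r)) \<longlongrightarrow> e / 2 * s) (at_right 0)"
      by simp
    show "\<forall>\<^sub>F r in at_right 0. cmod (h s - h r) \<le> e / 2 * (s - r)"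
      unfolding eventually_at_right_field using lip s by blast
  qed simp
  show "\<forall>\<^sub>F s in at_right 0. dist ((\<Phi> (of_real s) z - z) / of_real s) (G z) < e"
    unfolding eventually_at_right_field
  proof (intro exI conjI allI impI)
    fix s assume s: "0 < s" "s < d"
    have "(\<Phi> (of_real s) z - z) / of_real s - G z = (h s - z) / of_real s"
      using s by (simp add: h_def field_simps)
    then have "dist ((\<Phi> (of_real s) z - z) / of_real s) (G z) = cmod (h s - z) / s"
      using s by (simp add: dist_norm norm_divide)
    also have "\<dots> \<le> e / 2"
      using bound [OF s] s by (simp add: field_simps)
    also have "\<dots> < e"
      using e by simp
    finally show "dist ((\<Phi> (of_real s) z - z) / of_real s) (G z) < e" .
  qed (use d in auto)
qed

lemma limit_point_of_positive_reals: "(1::complex) islimpt of_real ` {0<..}"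
proof -
  have "(1::real) islimpt {0<..}"
    by (intro interior_limit_point) (simp add: interior_open)
  then show ?thesis
    unfolding islimpt_approachable
    by (metis (no_types, opaque_lifting) dist_of_real image_eqI of_real_1 of_real_eq_1_iff)
qed

text \<open>Both sides are holomorphic in \<open>\<xi>\<close> and agree at positive reals.\<close>

lemma semigroup_complex_time:
  assumes \<xi>: "\<xi> \<in> aperture_cone \<kappa>" and s: "0 < s" and z: "0 < Re z"
  shows "\<Phi> (\<xi> + of_real s) z = \<Phi> (of_real s) (\<Phi> \<xi> z)"
proof -
  have "\<Phi> (\<xi> + of_real s) z - \<Phi> (of_real s) (\<Phi> \<xi> z) = 0"
  proof (rule analytic_continuation [where S = "aperture_cone \<kappa>" and U = "of_real ` {0<..}" and \<xi> = 1
      and f = "\<lambda>\<xi>. \<Phi> (\<xi> + of_real s) z - \<Phi> (of_real s) (\<Phi> \<xi> z)" and w = \<xi>])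
    have "(\<lambda>\<xi>. \<Phi> (\<xi> + of_real s) z) holomorphic_on aperture_cone \<kappa>"
      by (rule holomorphic_on_compose_gen [OF _ hol_time [OF z], unfolded o_def])
        (auto intro!: holomorphic_intros cone_add_real \<kappa> s)
    moreover have "(\<lambda>\<xi>. \<Phi> (of_real s) (\<Phi> \<xi> z)) holomorphic_on aperture_cone \<kappa>"
      by (rule holomorphic_on_compose_gen [OF hol_time [OF z] hol_space, unfolded o_def])
        (use s maps z in auto)
    ultimately show "(\<lambda>\<xi>. \<Phi> (\<xi> + of_real s) z - \<Phi> (of_real s) (\<Phi> \<xi> z)) holomorphic_on aperture_cone \<kappa>"
      by (rule holomorphic_on_diff)
    show "(1::complex) islimpt of_real ` {0<..}"
      by (rule limit_point_of_positive_reals)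
    show "\<Phi> (t + of_real s) z - \<Phi> (of_real s) (\<Phi> t z) = 0" if "t \<in> of_real ` {0<..}" for t
      using that semigroup [OF s _ z] by auto
    show "(1::complex) \<in> aperture_cone \<kappa>"
      using real_in_cone [of 1] by simp
  qed (use open_aperture_cone convex_connected [OF convex_aperture_cone] \<xi> in auto)
  then show ?thesis by simp
qed

text \<open>The complex derivative exists, so it can be computed along real increments, where the semigroup
  law turns the difference quotient at \<open>\<xi>\<close> into the one at time \<open>0\<close> and the point \<open>\<Phi> \<xi> z\<close>.\<close>

lemma complex_time_ode:
  assumes \<xi>: "\<xi> \<in> aperture_cone \<kappa>" and z: "0 < Re z"
  shows "((\<lambda>\<xi>. \<Phi> \<xi> z) has_field_derivative G (\<Phi> \<xi> z)) (at \<xi>)"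
proof -
  let ?D = "deriv (\<lambda>\<xi>. \<Phi> \<xi> z) \<xi>"
  have "((\<lambda>h. (\<Phi> (\<xi> + h) z - \<Phi> \<xi> z) / h) \<longlongrightarrow> ?D) (at 0)"
    using time_derivative [OF \<xi> z] by (simp add: DERIV_def)
  moreover have "filterlim complex_of_real (at 0) (at_right 0)"
    unfolding filterlim_at
    by (auto intro!: tendsto_eq_intros simp: eventually_at_filter)
  ultimately have "((\<lambda>s. (\<Phi> (\<xi> + of_real s) z - \<Phi> \<xi> z) / of_real s) \<longlongrightarrow> ?D) (at_right 0)"
    by (rule filterlim_compose)
  moreover have "((\<lambda>s. (\<Phi> (\<xi> + of_real s) z - \<Phi> \<xi> z) / of_real s) \<longlongrightarrow> G (\<Phi> \<xi> z)) (at_right 0)"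
  proof (rule Lim_transform_eventually [OF real_generator [OF maps [OF \<xi> z]]])
    show "\<forall>\<^sub>F s in at_right 0. (\<Phi> (of_real s) (\<Phi> \<xi> z) - \<Phi> \<xi> z) / of_real s = (\<Phi> (\<xi> + of_real s) z - \<Phi> \<xi> z) / of_real s"
      using eventually_at_right_less [of 0] by eventually_elim (simp add: semigroup_complex_time \<xi> z)
  qed
  ultimately have "?D = G (\<Phi> \<xi> z)"
    using tendsto_unique trivial_limit_at_right_real by blast
  with time_derivative [OF \<xi> z] show ?thesis by simp
qed

text \<open>With \<open>w\<^sub>n \<xi> = \<Phi> (\<xi>/n) z\<close>, the function \<open>n w\<^sub>n \<xi> - \<xi> G(z)\<close> has derivative \<open>G(w\<^sub>n \<xi>) - G(z)\<close>, which tends to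
  \<open>0\<close> uniformly on the segment from \<open>1\<close> to \<open>e\<close>.  So its values at \<open>e\<close> and at \<open>1\<close> have the same
  limiting behaviour, and the value at \<open>1\<close> is governed by real times.\<close>

lemma generator_along_ray:
  assumes e: "e \<in> aperture_cone \<kappa>" and z: "0 < Re z"
  shows "(\<lambda>n. of_real (real (Suc n)) * (\<Phi> (e / of_real (real (Suc n))) z - z)) \<longlonglongrightarrow> e * G z"
proof -
  define N :: "nat \<Rightarrow> complex" where "N = (\<lambda>n. of_real (real (Suc n)))"
  define w where "w = (\<lambda>n \<xi>. \<Phi> (\<xi> / N n) z)"
  have N0 [simp]: "N n \<noteq> 0" for n
    unfolding N_def by (simp only: of_real_eq_0_iff)
  have scale: "\<xi> / N n \<in> aperture_cone \<kappa>" if "\<xi> \<in> aperture_cone \<kappa>" for \<xi> n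
    unfolding N_def by (rule cone_scale [OF that]) simp
  have one: "(1::complex) \<in> aperture_cone \<kappa>"
    using real_in_cone [of 1] by simp
  have w_pos: "0 < Re (w n \<xi>)" if "\<xi> \<in> aperture_cone \<kappa>" for n \<xi>
    unfolding w_def by (rule maps [OF scale [OF that] z])
  have w': "((w n) has_field_derivative G (w n \<xi>) / N n) (at \<xi>)" if "\<xi> \<in> aperture_cone \<kappa>" for n \<xi>
  proof -
    have "((\<lambda>\<xi>. \<xi> / N n) has_field_derivative 1 / N n) (at \<xi>)"
      by (auto intro!: derivative_eq_intros)
    from DERIV_chain2 [OF complex_time_ode [OF scale [OF that] z] this]
    show ?thesis
      unfolding w_def by simp
  qed
  let ?K = "closed_segment 1 e"
  have K: "?K \<subseteq> aperture_cone \<kappa>"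
    by (rule closed_segment_subset [OF one e convex_aperture_cone])
  have unif: "uniform_limit ?K (\<lambda>n \<xi>. inverse (w n \<xi> + 1)) (\<lambda>\<xi>. inverse (z + 1)) sequentially"
  proof (rule Vitali_bounded [where U = "aperture_cone \<kappa>" and E = "of_real ` {0<..}" and a = 1 and B = 1])
    show "(\<lambda>\<xi>. inverse (w n \<xi> + 1)) holomorphic_on aperture_cone \<kappa>" for n
    proof (intro holomorphic_intros)
      show "w n holomorphic_on aperture_cone \<kappa>"
        unfolding holomorphic_on_open [OF open_aperture_cone] using w' by blast
      show "w n \<xi> + 1 \<noteq> 0" if "\<xi> \<in> aperture_cone \<kappa>" for \<xi>
        by (rule plus_1_nonzero [OF w_pos [OF that]])
    qed
    show "cmod (inverse (w n \<xi> + 1)) \<le> 1" if "\<xi> \<in> aperture_cone \<kappa>" for n \<xi>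
      by (rule inverse_plus_1_le [OF w_pos [OF that]])
    show "(\<lambda>n. inverse (w n \<xi> + 1)) \<longlonglongrightarrow> inverse (z + 1)" if "\<xi> \<in> of_real ` {0<..}" for \<xi>
    proof -
      obtain t where t: "0 < t" "\<xi> = of_real t"
        using \<open>\<xi> \<in> of_real ` {0<..}\<close> by auto
      have "(\<lambda>n. t * inverse (real (Suc n))) \<longlonglongrightarrow> t * 0"
        by (intro tendsto_mult tendsto_const LIMSEQ_inverse_real_of_nat)
      then have "(\<lambda>n. t / real (Suc n)) \<longlonglongrightarrow> 0"
        by (simp add: divide_inverse)
      then have "(\<lambda>n. \<Phi> (of_real (t / real (Suc n))) z) \<longlonglongrightarrow> z"
        using continuous_at_0 [OF z] t(1) unfolding tendsto_at_iff_sequentially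
        by (auto simp: o_def dest!: spec [of _ "\<lambda>n. t / real (Suc n)"])
      then have "(\<lambda>n. w n \<xi>) \<longlonglongrightarrow> z"
        by (simp add: w_def N_def t(2))
      then show ?thesis
        using plus_1_nonzero [OF z] by (intro tendsto_intros)
    qed
  qed (use open_aperture_cone convex_connected [OF convex_aperture_cone] one K limit_point_of_positive_reals in auto)
  \<comment> \<open>Convergence is known for \<open>p = 1 / (w\<^sub>n + 1)\<close>, from which \<open>w\<^sub>n\<close> is \<open>1 / p - 1\<close>.\<close>
  have cont: "isCont (\<lambda>p. G (inverse p - 1)) (inverse (z + 1))"
  proof -
    have "isCont G z"
      using holomorphic_on_imp_continuous_on [OF hol_G] z by (simp add: continuous_on_eq_continuous_at)
    then have "isCont G (inverse (inverse (z + 1)) - 1)"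
      by simp
    moreover have "isCont (\<lambda>p. inverse p - 1) (inverse (z + 1))"
      using plus_1_nonzero [OF z] by (intro continuous_intros) auto
    ultimately show ?thesis
      by (rule isCont_o2 [rotated])
  qed
  have diff: "(\<lambda>n. (N n * w n e - e * G z) - (N n * w n 1 - 1 * G z)) \<longlonglongrightarrow> 0"
  proof (rule tendstoI)
    fix \<epsilon> :: real assume \<epsilon>: "0 < \<epsilon>"
    \<comment> \<open>Adding \<open>1\<close> allows for \<open>e = 1\<close>.\<close>
    define b where "b = \<epsilon> / (cmod (e - 1) + 1)"
    have b: "0 < b" "b * cmod (e - 1) < \<epsilon>"
    proof -
      have pos: "0 < cmod (e - 1) + 1"
        by (simp add: add_nonneg_pos)
      with \<epsilon> show "0 < b"
        by (simp add: b_def)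
      show "b * cmod (e - 1) < \<epsilon>"
        using \<epsilon> pos_divide_less_eq [OF pos, of "\<epsilon> * cmod (e - 1)" \<epsilon>] by (simp add: b_def algebra_simps)
    qed
    obtain d where d: "0 < d"
      and close: "\<And>p. dist p (inverse (z + 1)) < d \<Longrightarrow> dist (G (inverse p - 1)) (G z) < b"
      using cont b(1) unfolding continuous_at_eps_delta by (auto simp: dist_norm)
    have "\<forall>\<^sub>F n in sequentially. \<forall>\<xi>\<in>?K. dist (inverse (w n \<xi> + 1)) (inverse (z + 1)) < d"
      using unif d by (simp add: uniform_limit_iff)
    then show "\<forall>\<^sub>F n in sequentially.
      dist ((N n * w n e - e * G z) - (N n * w n 1 - 1 * G z)) 0 < \<epsilon>"
    proof eventually_elim
      case (elim n)
      have "cmod ((N n * w n e - e * G z) - (N n * w n 1 - 1 * G z)) \<le> b * cmod (e - 1)"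
      proof (rule field_differentiable_bound [where S = ?K and f' = "\<lambda>\<xi>. G (w n \<xi>) - G z"])
        fix \<xi> assume \<xi>: "\<xi> \<in> ?K"
        have "((\<lambda>\<xi>. N n * w n \<xi> - \<xi> * G z) has_field_derivative N n * (G (w n \<xi>) / N n) - 1 * G z) (at \<xi>)"
          using w' [of \<xi> n] \<xi> K by (intro derivative_intros DERIV_cmult DERIV_cmult_right) auto
        then show "((\<lambda>\<xi>. N n * w n \<xi> - \<xi> * G z) has_field_derivative G (w n \<xi>) - G z) (at \<xi> within ?K)"
          by (simp add: has_field_derivative_at_within)
        show "cmod (G (w n \<xi>) - G z) \<le> b"
          using close [OF elim [rule_format, OF \<xi>]] by (simp add: dist_norm)
      qed auto
      with b(2) show ?case by simp
    qed
  qed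
  have real: "(\<lambda>n. N n * w n 1 - N n * z) \<longlonglongrightarrow> G z"
  proof -
    have "(\<lambda>n. (\<Phi> (of_real (inverse (real (Suc n)))) z - z) / of_real (inverse (real (Suc n)))) \<longlonglongrightarrow> G z"
      using real_generator [OF z] LIMSEQ_inverse_real_of_nat unfolding tendsto_at_iff_sequentially
      by (auto simp: o_def dest!: spec [of _ "\<lambda>n. inverse (real (Suc n))"])
    moreover have "(\<Phi> (of_real (inverse (real (Suc n)))) z - z) / of_real (inverse (real (Suc n)))
        = N n * w n 1 - N n * z" for n
      unfolding w_def N_def of_real_inverse divide_inverse inverse_inverse_eq mult_1_left
      by (simp add: algebra_simps)
    ultimately show ?thesis by simp
  qed
  have "(\<lambda>n. (N n * w n e - e * G z) - (N n * w n 1 - 1 * G z) + (N n * w n 1 - N n * z) + (e * G z - G z)) \<longlonglongrightarrow> 0 + G z + (e * G z - G z)"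
    by (intro tendsto_add diff real tendsto_const)
  moreover have "(N n * w n e - e * G z) - (N n * w n 1 - 1 * G z) + (N n * w n 1 - N n * z) + (e * G z - G z)
      = N n * (w n e - z)" for n
    by (simp add: algebra_simps)
  ultimately show ?thesis
    by (simp add: w_def N_def)
qed

lemma generator_antimono:
  assumes e: "e \<in> aperture_cone \<kappa>" and x: "0 < x" "x \<le> x'"
  shows "Re (e * G (Complex x' y)) / x' \<le> Re (e * G (Complex x y)) / x"
proof -
  define q where "q = (\<lambda>n t. Re (of_real (real (Suc n)) * (\<Phi> (e / of_real (real (Suc n))) (Complex t y) - Complex t y)) / t)"
  have lim: "(\<lambda>n. q n t) \<longlonglongrightarrow> Re (e * G (Complex t y)) / t" if "0 < t" for t
    unfolding q_def using that by (intro tendsto_divide tendsto_Re tendsto_const generator_along_ray e) auto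
  show ?thesis
  proof (rule LIMSEQ_le [OF lim lim])
    show "\<exists>N. \<forall>n\<ge>N. q n x' \<le> q n x"
    proof (intro exI allI impI)
      fix n
      let ?\<phi> = "\<Phi> (e / of_real (real (Suc n)))"
      have in_cone: "e / of_real (real (Suc n)) \<in> aperture_cone \<kappa>"
        by (rule cone_scale [OF e]) simp
      have "Re (?\<phi> (Complex x' y)) / x' \<le> Re (?\<phi> (Complex x y)) / x"
        by (rule Re_over_x_antimono [OF hol_space _ x]) (use in_cone maps in auto)
      then have "real (Suc n) * (Re (?\<phi> (Complex x' y)) / x' - 1) \<le> real (Suc n) * (Re (?\<phi> (Complex x y)) / x - 1)"
        by (intro mult_left_mono) auto
      moreover have "q n t = real (Suc n) * (Re (?\<phi> (Complex t y)) / t - 1)" if "0 < t" for t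
        unfolding q_def scaleR_conv_of_real [symmetric] scaleR_complex.simps using that by (simp add: field_simps)
      ultimately show "q n x' \<le> q n x"
        using x by simp
    qed
  qed (use x in auto)
qed

end

section \<open>From composition semigroups to semiflows\<close>

lemma op_differentiable_pointwise:
  assumes bounded: "\<forall>\<^sub>F h in at 0. bounded_op (S (\<xi> + h))" "bounded_op (S \<xi>)" "bounded_op D"
    and lim: "((\<lambda>h. op_norm (\<lambda>f z. (S (\<xi> + h) f z - S \<xi> f z) / h - D f z)) \<longlongrightarrow> 0) (at 0)"
    and f: "f \<in> hardy2" "hardy2_norm f \<le> 1" and z: "0 < Re z"
  shows "((\<lambda>\<xi>. S \<xi> f z) has_field_derivative D f z) (at \<xi>)"
proof -
  let ?Q = "\<lambda>h z. (S (\<xi> + h) f z - S \<xi> f z) / h - D f z"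
  let ?N = "\<lambda>h. op_norm (\<lambda>f z. (S (\<xi> + h) f z - S \<xi> f z) / h - D f z)"
  have "((\<lambda>h. ?Q h z) \<longlongrightarrow> 0) (at 0)"
  proof (rule Lim_null_comparison)
    show "((\<lambda>h. ?N h * (1 + 2 / Re z)) \<longlongrightarrow> 0) (at 0)"
      by (rule tendsto_mult_left_zero [OF lim])
    show "\<forall>\<^sub>F h in at 0. cmod (?Q h z) \<le> ?N h * (1 + 2 / Re z)"
      using bounded(1)
    proof eventually_elim
      case (elim h)
      note quot = difference_quotient_le_op_norm [OF elim bounded(2,3) f, of h]
      have "cmod (?Q h z) \<le> hardy2_norm (?Q h) * (1 + 2 / Re z)"
        by (rule hardy2_point_evaluation [OF quot(1) z])
      also have "\<dots> \<le> ?N h * (1 + 2 / Re z)"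
        using quot(2) z by (intro mult_right_mono) auto
      finally show ?case .
    qed
  qed
  then show ?thesis
    unfolding DERIV_def by (rule LIM_zero_cancel)
qed

lemma test_function_inverse:
  "0 < Re w \<Longrightarrow> inverse (2 * test_function w) - 1 = w"
  by (simp add: test_function_def)

lemma test_function_neq_0: "0 < Re w \<Longrightarrow> test_function w \<noteq> 0"
proof -
  assume w: "0 < Re w"
  then have "0 < Re (w + 1)" by simp
  then have "w + 1 \<noteq> 0" by (metis less_irrefl zero_complex.simps(1))
  then show ?thesis using w by (simp add: test_function_def)
qed

lemma holomorphic_test_function: "test_function holomorphic_on right_half_plane"
  using test_function_in_hardy2(1) by (simp add: hardy2_def)

text \<open>The test function has a differentiable left inverse.\<close>

lemma deriv_test_function_neq_0:
  assumes "0 < Re w"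
  shows "deriv test_function w \<noteq> 0"
proof
  assume 0: "deriv test_function w = 0"
  have "(test_function has_field_derivative 0) (at w)"
    using holomorphic_derivI [OF holomorphic_test_function open_right_half_plane, of w] assms 0 by simp
  then have "((\<lambda>w. inverse (2 * test_function w) - 1) has_field_derivative 0) (at w)"
    using test_function_neq_0 [OF assms] by (auto intro!: derivative_eq_intros)
  then have "((\<lambda>w. w) has_field_derivative (0 :: complex)) (at w)"
    by (rule has_field_derivative_transform_within_open [OF _ open_right_half_plane])
      (use assms test_function_inverse in auto)
  then show False
    using DERIV_unique [OF _ DERIV_ident] by fastforce
qed

lemma filterlim_of_real_at_0: "filterlim complex_of_real (at 0) (at_right 0)"
  unfolding filterlim_at
  by (auto intro!: tendsto_eq_intros simp: eventually_at_filter)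

text \<open>An analytic semigroup maps every function into the domain of its generator at once: the
  right-hand difference quotient of the semigroup at \<open>0\<close>, applied to \<open>T s f\<close>, is the difference
  quotient of \<open>S\<close> at \<open>s\<close>, applied to \<open>f\<close>.\<close>

lemma analytic_semigroup_in_generator_graph:
  assumes ext: "analytic_extension \<theta> S T" and T: "C0_semigroup T"
    and s: "0 < s" and f: "f \<in> hardy2" "hardy2_norm f \<le> 1" and \<theta>: "0 < \<theta>"
    and D: "bounded_op D"
      "((\<lambda>h. op_norm (\<lambda>f z. (S (of_real s + h) f z - S (of_real s) f z) / h - D f z)) \<longlongrightarrow> 0) (at 0)"
  shows "(T s f, D f) \<in> generator_graph T"
proof -
  have real: "S (of_real t) f = T t f" if "0 \<le> t" for t
    using ext f that by (simp add: analytic_extension_def)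
  have bounded: "bounded_op (S (of_real t))" if "0 \<le> t" for t
  proof -
    have "complex_of_real t = of_real t * cis 0" by simp
    then have "complex_of_real t \<in> sector \<theta>"
      using that \<theta> unfolding sector_def by fastforce
    then show ?thesis
      using ext by (simp add: analytic_extension_def)
  qed
  let ?N = "\<lambda>h. op_norm (\<lambda>f z. (S (of_real s + h) f z - S (of_real s) f z) / h - D f z)"
  have "((\<lambda>t. hardy2_norm (\<lambda>z. (T t (T s f) z - T s f z) / of_real t - D f z)) \<longlongrightarrow> 0) (at_right 0)"
  proof (rule Lim_null_comparison)
    show "((\<lambda>t. ?N (of_real t)) \<longlongrightarrow> 0) (at_right 0)"
      by (rule filterlim_compose [OF D(2) filterlim_of_real_at_0])
    show "\<forall>\<^sub>F t in at_right 0. norm (hardy2_norm (\<lambda>z. (T t (T s f) z - T s f z) / of_real t - D f z)) \<le> ?N (of_real t)"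
      using eventually_at_right_less [of 0]
    proof eventually_elim
      case (elim t)
      have "T t (T s f) = T (t + s) f"
        using T elim s f by (simp add: C0_semigroup_def)
      also have "\<dots> = S (of_real s + of_real t) f"
        using real [of "t + s"] elim s by (simp add: add.commute)
      finally have "T t (T s f) = S (of_real s + of_real t) f" .
      moreover have "bounded_op (S (of_real s + of_real t))"
        using bounded [of "s + t"] elim s by simp
      ultimately show ?case
        using difference_quotient_le_op_norm(2) [OF _ bounded D(1) f, of "S (of_real s + of_real t)" s "of_real t"]
          elim s real [of s] by simp
    qed
  qed
  moreover have "T s f \<in> hardy2" "D f \<in> hardy2"
    using T D(1) s f by (auto simp: C0_semigroup_def bounded_op_def)
  ultimately show ?thesis
    by (simp add: generator_graph_def)
qed

text \<open>Every property of \<open>\<Phi>\<close> is read off from \<open>S \<xi> k = k \<circ> \<Phi> \<xi>\<close> with the test function \<open>k\<close>, since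
  \<open>k\<close> is invertible.  For the transport equation, \<open>D k\<close> is the derivative of \<open>S \<xi> k\<close> at \<open>\<xi> = s\<close>;
  the generator identity for \<open>(T s k, D k)\<close> then reads
  \<open>k'(\<Phi> s z) \<cdot> \<partial>\<^sub>s \<Phi> s z = G(z) \<cdot> k'(\<Phi> s z) \<cdot> \<partial>\<^sub>z \<Phi> s z\<close>, and \<open>k'\<close> has no zeros.\<close>

lemma analytic_semiflow_of_composition_semigroup:
  assumes hol_G: "G holomorphic_on right_half_plane"
    and T: "C0_semigroup T" and gen: "generated_by G T"
    and \<theta>: "0 < \<theta>" and ext: "analytic_extension \<theta> S T"
    and comp: "\<forall>\<xi>\<in>sector \<theta>. is_composition_operator (S \<xi>)"
    and \<beta>: "0 < \<beta>" "\<beta> < pi / 2" "\<beta> \<le> \<theta>"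
  obtains \<Phi> where "analytic_semiflow (tan \<beta>) \<Phi> G"
proof -
  let ?k = test_function
  note k = test_function_in_hardy2
  obtain \<Phi> where \<Phi>: "\<forall>\<xi>\<in>sector \<theta>. \<Phi> \<xi> holomorphic_on right_half_plane \<and>
      \<Phi> \<xi> ` right_half_plane \<subseteq> right_half_plane \<and>
      (\<forall>f\<in>hardy2. \<forall>z\<in>right_half_plane. S \<xi> f z = f (\<Phi> \<xi> z))"
    using bchoice [OF comp [unfolded is_composition_operator_def]] by blast
  have hol: "\<Phi> \<xi> holomorphic_on right_half_plane" if "\<xi> \<in> sector \<theta>" for \<xi>
    using \<Phi> that by blast
  have maps: "0 < Re (\<Phi> \<xi> z)" if "\<xi> \<in> sector \<theta>" "0 < Re z" for \<xi> z
    using \<Phi> that by (auto simp: image_subset_iff)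
  have S_eq: "S \<xi> f z = f (\<Phi> \<xi> z)" if "\<xi> \<in> sector \<theta>" "f \<in> hardy2" "0 < Re z" for \<xi> f z
    using \<Phi> that by simp
  have \<Phi>_eq: "\<Phi> \<xi> z = inverse (2 * S \<xi> ?k z) - 1" if "\<xi> \<in> sector \<theta>" "0 < Re z" for \<xi> z
    using test_function_inverse [OF maps [OF that]] S_eq [OF that(1) k(1) that(2)] by simp
  have sub: "aperture_cone (tan \<beta>) \<subseteq> sector \<theta>" and nz: "0 \<notin> aperture_cone (tan \<beta>)"
    using cone_subset_sector [OF \<beta>] by auto
  have tan_pos: "0 < tan \<beta>"
    using \<beta> by (intro tan_gt_zero) auto
  have real_sector: "of_real t \<in> sector \<theta>" if "0 < t" for t
    using sub of_real_in_cone [OF tan_pos that] by auto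
  have S_real: "S (of_real t) f = T t f" if "0 \<le> t" "f \<in> hardy2" for t f
    using ext that by (simp add: analytic_extension_def)
  have bounded: "bounded_op (S \<xi>)" if "\<xi> \<in> sector \<theta>" for \<xi>
    using ext that by (simp add: analytic_extension_def)
  have mem: "T t ?k \<in> hardy2" if "0 \<le> t" for t
    using T that k by (auto simp: C0_semigroup_def bounded_op_def)
  have T_eq: "T t f z = f (\<Phi> (of_real t) z)" if "0 < t" "f \<in> hardy2" "0 < Re z" for t f z
    using S_eq [OF real_sector [OF that(1)] that(2,3)] S_real [of t f] that by simp
  have deriv_ex: "\<exists>D. bounded_op D \<and>
      ((\<lambda>h. op_norm (\<lambda>f z. (S (\<xi> + h) f z - S \<xi> f z) / h - D f z)) \<longlongrightarrow> 0) (at 0) \<and>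
      (\<forall>z. 0 < Re z \<longrightarrow> ((\<lambda>\<xi>. S \<xi> ?k z) has_field_derivative D ?k z) (at \<xi>))"
    if \<xi>: "\<xi> \<in> aperture_cone (tan \<beta>)" for \<xi>
  proof -
    have "\<xi> \<in> sector \<theta> - {0}"
      using \<xi> sub nz by auto
    then have "op_differentiable_at S \<xi>"
      using ext by (simp add: analytic_extension_def)
    then obtain D where D: "bounded_op D"
      "((\<lambda>h. op_norm (\<lambda>f z. (S (\<xi> + h) f z - S \<xi> f z) / h - D f z)) \<longlongrightarrow> 0) (at 0)"
      unfolding op_differentiable_at_def by blast
    have "((\<lambda>h. \<xi> + h) \<longlongrightarrow> \<xi> + 0) (at 0)"
      by (intro tendsto_intros)
    then have "\<forall>\<^sub>F h in at 0. \<xi> + h \<in> aperture_cone (tan \<beta>)"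
      using \<xi> by (intro topological_tendstoD [OF _ open_aperture_cone]) auto
    then have "\<forall>\<^sub>F h in at 0. bounded_op (S (\<xi> + h))"
      by eventually_elim (use sub bounded in auto)
    then have "\<forall>z. 0 < Re z \<longrightarrow> ((\<lambda>\<xi>. S \<xi> ?k z) has_field_derivative D ?k z) (at \<xi>)"
      using op_differentiable_pointwise [OF _ bounded D k] sub \<xi> by auto
    with D show ?thesis
      by (intro exI [of _ D] conjI)
  qed
  have hol_time: "(\<lambda>\<xi>. \<Phi> \<xi> z) holomorphic_on aperture_cone (tan \<beta>)" if z: "0 < Re z" for z
  proof -
    have "(\<lambda>\<xi>. S \<xi> ?k z) holomorphic_on aperture_cone (tan \<beta>)"
      unfolding holomorphic_on_open [OF open_aperture_cone] using deriv_ex z by blast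
    moreover have "S \<xi> ?k z \<noteq> 0" if "\<xi> \<in> aperture_cone (tan \<beta>)" for \<xi>
      using that sub S_eq [OF _ k(1) z] test_function_neq_0 [OF maps [OF _ z]] by auto
    ultimately have "(\<lambda>\<xi>. inverse (2 * S \<xi> ?k z) - 1) holomorphic_on aperture_cone (tan \<beta>)"
      by (intro holomorphic_intros) auto
    then show ?thesis
      by (rule holomorphic_transform) (use sub \<Phi>_eq z in auto)
  qed
  have "analytic_semiflow (tan \<beta>) \<Phi> G"
  proof
    show "0 < tan \<beta>" by (rule tan_pos)
    show "G holomorphic_on right_half_plane" by (rule hol_G)
    show "\<Phi> \<xi> holomorphic_on right_half_plane" if "\<xi> \<in> aperture_cone (tan \<beta>)" for \<xi>
      using that sub hol by blast
    show "0 < Re (\<Phi> \<xi> z)" if "\<xi> \<in> aperture_cone (tan \<beta>)" "0 < Re z" for \<xi> z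
      using that sub maps by blast
    show "(\<lambda>\<xi>. \<Phi> \<xi> z) holomorphic_on aperture_cone (tan \<beta>)" if "0 < Re z" for z
      by (rule hol_time [OF that])
    show "\<Phi> (of_real (t + s)) z = \<Phi> (of_real s) (\<Phi> (of_real t) z)"
      if "0 < s" "0 < t" "0 < Re z" for s t z
    proof -
      have w: "0 < Re (\<Phi> (of_real t) z)"
        using maps real_sector that by blast
      have "?k (\<Phi> (of_real (t + s)) z) = T (t + s) ?k z"
        using T_eq [of "t + s" ?k z] k that by simp
      also have "\<dots> = T t (T s ?k) z"
        using T that k by (simp add: C0_semigroup_def)
      also have "\<dots> = ?k (\<Phi> (of_real s) (\<Phi> (of_real t) z))"
        using T_eq [OF _ k(1)] T_eq [of t "T s ?k" z] mem [of s] that w by simp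
      finally have "?k (\<Phi> (of_real (t + s)) z) = ?k (\<Phi> (of_real s) (\<Phi> (of_real t) z))" .
      then show ?thesis
        using test_function_inverse maps real_sector that w by (metis add_pos_pos)
    qed
    show "((\<lambda>t. \<Phi> (of_real t) z) \<longlongrightarrow> z) (at_right 0)" if z: "0 < Re z" for z
    proof -
      have "((\<lambda>t. T t ?k z - ?k z) \<longlongrightarrow> 0) (at_right 0)"
      proof (rule Lim_null_comparison)
        have "((\<lambda>t. hardy2_norm (\<lambda>z. T t ?k z - ?k z)) \<longlongrightarrow> 0) (at_right 0)"
          using T k by (simp add: C0_semigroup_def)
        then show "((\<lambda>t. hardy2_norm (\<lambda>z. T t ?k z - ?k z) * (1 + 2 / Re z)) \<longlongrightarrow> 0) (at_right 0)"
          by (rule tendsto_mult_left_zero)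
        show "\<forall>\<^sub>F t in at_right 0. cmod (T t ?k z - ?k z) \<le> hardy2_norm (\<lambda>z. T t ?k z - ?k z) * (1 + 2 / Re z)"
          using eventually_at_right_less [of 0]
        proof eventually_elim
          case (elim t)
          show ?case
            by (rule hardy2_point_evaluation [OF hardy2_diff(1) z]) (use mem elim k in auto)
        qed
      qed
      then have "((\<lambda>t. T t ?k z) \<longlongrightarrow> ?k z) (at_right 0)"
        by (rule LIM_zero_cancel)
      then have "((\<lambda>t. inverse (2 * T t ?k z) - 1) \<longlongrightarrow> inverse (2 * ?k z) - 1) (at_right 0)"
        using test_function_neq_0 [OF z] by (intro tendsto_intros) auto
      then have "((\<lambda>t. inverse (2 * T t ?k z) - 1) \<longlongrightarrow> z) (at_right 0)"
        unfolding test_function_inverse [OF z] .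
      then show ?thesis
      proof (rule Lim_transform_eventually)
        show "\<forall>\<^sub>F t in at_right 0. inverse (2 * T t ?k z) - 1 = \<Phi> (of_real t) z"
          using eventually_at_right_less [of 0]
          by eventually_elim (simp add: \<Phi>_eq real_sector z S_real k)
      qed
    qed
    show "deriv (\<lambda>\<xi>. \<Phi> \<xi> z) (of_real s) = G z * deriv (\<Phi> (of_real s)) z"
      if s: "0 < s" and z: "0 < Re z" for s z
    proof -
      let ?w = "\<Phi> (of_real s) z"
      have w: "0 < Re ?w"
        using maps real_sector s z by blast
      obtain D where D: "bounded_op D"
        "((\<lambda>h. op_norm (\<lambda>f z. (S (of_real s + h) f z - S (of_real s) f z) / h - D f z)) \<longlongrightarrow> 0) (at 0)"
        "((\<lambda>\<xi>. S \<xi> ?k z) has_field_derivative D ?k z) (at (of_real s))"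
        using deriv_ex [OF of_real_in_cone [OF tan_pos s]] z by blast
      have k': "(?k has_field_derivative deriv ?k ?w) (at ?w)"
        using holomorphic_derivI [OF holomorphic_test_function open_right_half_plane] w by simp
      have "(T s ?k, D ?k) \<in> generator_graph T"
        by (rule analytic_semigroup_in_generator_graph [OF ext T s k \<theta> D(1,2)])
      then have "D ?k z = G z * deriv (T s ?k) z"
        using gen z unfolding generated_by_def by auto
      moreover have "deriv (T s ?k) z = deriv ?k ?w * deriv (\<Phi> (of_real s)) z"
      proof (rule DERIV_imp_deriv)
        have "((\<lambda>z. ?k (\<Phi> (of_real s) z)) has_field_derivative deriv ?k ?w * deriv (\<Phi> (of_real s)) z) (at z)"
          by (rule DERIV_chain2 [OF k' holomorphic_derivI [OF hol open_right_half_plane]])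
            (use real_sector s z in auto)
        then show "(T s ?k has_field_derivative deriv ?k ?w * deriv (\<Phi> (of_real s)) z) (at z)"
          by (rule has_field_derivative_transform_within_open [OF _ open_right_half_plane])
            (use z T_eq s k in auto)
      qed
      moreover have "D ?k z = deriv ?k ?w * deriv (\<lambda>\<xi>. \<Phi> \<xi> z) (of_real s)"
      proof (rule DERIV_unique)
        show "((\<lambda>\<xi>. S \<xi> ?k z) has_field_derivative D ?k z) (at (of_real s))"
          by (rule D(3))
        have "((\<lambda>\<xi>. \<Phi> \<xi> z) has_field_derivative deriv (\<lambda>\<xi>. \<Phi> \<xi> z) (of_real s)) (at (of_real s))"
          by (rule holomorphic_derivI [OF hol_time [OF z] open_aperture_cone of_real_in_cone [OF tan_pos s]])
        from DERIV_chain2 [OF k' this]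
        show "((\<lambda>\<xi>. S \<xi> ?k z) has_field_derivative deriv ?k ?w * deriv (\<lambda>\<xi>. \<Phi> \<xi> z) (of_real s)) (at (of_real s))"
          by (rule has_field_derivative_transform_within_open [OF _ open_aperture_cone of_real_in_cone [OF tan_pos s]])
            (use sub S_eq z k in auto)
      qed
      ultimately show ?thesis
        using deriv_test_function_neq_0 [OF w] by simp
    qed
  qed
  then show thesis by (rule that)
qed

theorem proposition4p3:
  fixes G :: "complex \<Rightarrow> complex"
  assumes "G holomorphic_on right_half_plane"
    and "\<exists>T. analytic_composition_semigroup T \<and> generated_by G T"
  shows "\<exists>\<alpha>. 0 < \<alpha> \<and> \<alpha> < pi / 2 \<and>
    (\<forall>y. \<forall>\<theta>\<in>{-\<alpha>..\<alpha>}.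
       antimono_on {0<..}
         (\<lambda>x. (Re (G (Complex x y)) * cos \<theta> + Im (G (Complex x y)) * sin \<theta>) / x))"
proof -
  obtain T \<theta> S where T: "C0_semigroup T" "generated_by G T"
    and \<theta>: "0 < \<theta>" "\<theta> \<le> pi / 2" and ext: "analytic_extension \<theta> S T"
    and comp: "\<forall>\<xi>\<in>sector \<theta>. is_composition_operator (S \<xi>)"
    using assms(2) unfolding analytic_composition_semigroup_def by blast
  \<comment> \<open>The sector may be the open half-plane; halving its angle makes \<open>tan \<beta>\<close> meaningful.\<close>
  define \<beta> where "\<beta> = \<theta> / 2"
  have \<beta>: "0 < \<beta>" "\<beta> < pi / 2" "\<beta> \<le> \<theta>"
    using \<theta> pi_gt_zero unfolding \<beta>_def by linarith+
  obtain \<Phi> where "analytic_semiflow (tan \<beta>) \<Phi> G"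
    by (rule analytic_semiflow_of_composition_semigroup [OF assms(1) T \<theta>(1) ext comp \<beta>])
  then interpret analytic_semiflow "tan \<beta>" \<Phi> G .
  show ?thesis
  proof (intro exI [of _ "\<beta> / 2"] conjI allI ballI)
    fix y \<phi> :: real assume \<phi>: "\<phi> \<in> {- (\<beta> / 2)..\<beta> / 2}"
    \<comment> \<open>The direction \<open>cis (- \<phi>)\<close> belongs to the angle \<open>\<phi>\<close> of the statement.\<close>
    have eq: "Re (cis (- \<phi>) * w) = Re w * cos \<phi> + Im w * sin \<phi>" for w
      by (simp add: algebra_simps)
    have "cis (- \<phi>) \<in> aperture_cone (tan \<beta>)"
      by (rule cis_in_cone) (use \<phi> \<beta> in auto)
    then show "antimono_on {0<..} (\<lambda>x. (Re (G (Complex x y)) * cos \<phi> + Im (G (Complex x y)) * sin \<phi>) / x)"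
      unfolding eq [symmetric] by (intro monotone_onI generator_antimono) auto
  qed (use \<beta> in auto)
qed

end
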